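(* Let $K$ be a field and $S=K[x_1,\dots,x_n]$ with the standard grading. If $$E:\quad 0\to E^0\to\cdots\to E^n\to0$$ is a complex of (finitely generated) graded free $S$-modules and $F$ is a (not necessarily minimal) graded free resolution of a finitely generated graded $S$-module $M$, then: 1. $\langle F,E\rangle\ge0$. 2. Suppose in addition that $M$ and the modules $H^j(E)$, for $j>0$, have finite length. If $$0>\operatorname{reg}M+\operatorname{reg}E^0,\quad\text{and}\quad 0>\operatorname{reg}F_{j-1}+\operatorname{reg}H^j(E)\ \text{ for every } j>0,$$ then $\langle F,E\rangle=0$.
   Context: All modules are finitely generated graded $S$-modules and all maps are homogeneous of degree $0$. Free resolutions $F:\ F_0\leftarrow F_1\leftarrow\cdots\leftarrow F_n\leftarrow0$ have length at most $n$ and consist of finitely generated graded free modules $F_i=\bigoplus_kS(-k)^{\beta_{i,k}}$. For a graded module $N$, $N_0$ denotes its degree $0$ component. The pairing is $$\langle F,E\rangle=\sum_{j}\ \sum_{i\ge j}(-1)^{i-j}\dim_K\bigl((F_i\otimes_S H^j(E))_0\bigr)=\sum_{\{i,j,k\mid j\le i\}}(-1)^{i-j}\beta_{i,k}\,\dim_K H^j(E)_{-k},$$ where $H^j(E)$ is the $j$-th cohomology of $E$. $\operatorname{reg}$ denotes Castelnuovo-Mumford regularity over $S$; for a graded free module it is the maximal degree of a generator, for a module of finite length it is the maximal degree of a nonzero element, and $\operatorname{reg}0=-\infty$. *)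

theory Defs
  imports
    "Jordan_Normal_Form.VS_Connect"
    "HOL-Library.Poly_Mapping"
    "HOL-Library.Extended_Real"
    "HOL-Algebra.AbelCoset"
begin

section \<open>The standard graded polynomial ring\<close>

text \<open>
  A monomial is a finitely supported exponent vector \<open>nat \<Rightarrow>\<^sub>0 nat\<close>, and
  \<open>(nat \<Rightarrow>\<^sub>0 nat) \<Rightarrow>\<^sub>0 'k\<close> is the polynomial ring in countably many variables.
  The ring \<open>K[x\<^sub>1,\<dots>,x\<^sub>n]\<close> is its subring of polynomials in the variables with index
  \<open>0,\<dots>,n-1\<close>.
\<close>

type_synonym 'k mpoly = "(nat \<Rightarrow>\<^sub>0 nat) \<Rightarrow>\<^sub>0 'k"

definition poly_ring :: "nat \<Rightarrow> 'k::field mpoly ring" where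
  "poly_ring n = \<lparr>carrier = {p. \<forall>m\<in>Poly_Mapping.keys p. Poly_Mapping.keys m \<subseteq> {..<n}},
     mult = (*), one = 1, zero = 0, add = (+)\<rparr>"

definition mon_degree :: "(nat \<Rightarrow>\<^sub>0 nat) \<Rightarrow> nat" where
  "mon_degree m = (\<Sum>v\<in>Poly_Mapping.keys m. Poly_Mapping.lookup m v)"

definition poly_comp :: "nat \<Rightarrow> int \<Rightarrow> 'k::field mpoly set" where
  "poly_comp n d = {p \<in> carrier (poly_ring n). \<forall>m\<in>Poly_Mapping.keys p. int (mon_degree m) = d}"


section \<open>Graded modules\<close>

record ('a, 'b) gr_module = "('a, 'b) module" +
  hcomp :: "int \<Rightarrow> 'b set"

locale graded_module = Module.module "poly_ring n" M
  for n :: nat and M :: "('k::field mpoly, 'm) gr_module" (structure) +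
  assumes hcomp_subgroup: "subgroup (hcomp M d) (add_monoid M)"
    and hcomp_smult: "\<lbrakk>p \<in> poly_comp n c; x \<in> hcomp M d\<rbrakk> \<Longrightarrow> p \<odot> x \<in> hcomp M (c + d)"
    and hcomp_direct_sum: "x \<in> carrier M \<Longrightarrow>
      \<exists>!u. (\<forall>d. u d \<in> hcomp M d) \<and> finite {d. u d \<noteq> \<zero>} \<and> x = (\<Oplus>d\<in>{d. u d \<noteq> \<zero>}. u d)"

definition fin_gen_module :: "nat \<Rightarrow> ('k::field mpoly, 'm) gr_module \<Rightarrow> bool" where
  "fin_gen_module n M \<longleftrightarrow>
     (\<exists>A. finite A \<and> A \<subseteq> carrier M \<and> LinearCombinations.module.span (poly_ring n) M A = carrier M)"

text \<open>The length of a module is the supremum of the lengths of its strict chains of submodules.\<close>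

definition finite_length :: "nat \<Rightarrow> ('k::field mpoly, 'm) gr_module \<Rightarrow> bool" where
  "finite_length n M \<longleftrightarrow>
     (\<exists>L. \<forall>l (N :: nat \<Rightarrow> 'm set).
        (\<forall>i\<le>l. submodule (poly_ring n) (N i) M) \<and> (\<forall>i<l. N i \<subset> N (Suc i)) \<longrightarrow> l \<le> L)"

definition graded_hom ::
  "nat \<Rightarrow> ('k::field mpoly, 'a) gr_module \<Rightarrow> ('k mpoly, 'b) gr_module \<Rightarrow> ('a \<Rightarrow> 'b) \<Rightarrow> bool" where
  "graded_hom n M N h \<longleftrightarrow>
     h \<in> LinearCombinations.module_hom (poly_ring n) M N \<and> (\<forall>d. h ` hcomp M d \<subseteq> hcomp N d)"

text \<open>The component of degree \<open>d\<close> as a vector space over the constants \<open>K \<subseteq> S\<close>.\<close>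

definition comp_space :: "('k::field mpoly, 'm) gr_module \<Rightarrow> int \<Rightarrow> ('k, 'm) module" where
  "comp_space M d = \<lparr>carrier = hcomp M d, mult = mult M, one = one M, zero = zero M, add = add M,
     smult = (\<lambda>c x. Poly_Mapping.single 0 c \<odot>\<^bsub>M\<^esub> x)\<rparr>"

definition comp_dim :: "('k::field mpoly, 'm) gr_module \<Rightarrow> int \<Rightarrow> nat" where
  "comp_dim M d = vectorspace.dim (class_ring :: 'k ring) (comp_space M d)"

text \<open>The module \<open>Z/B\<close> of cosets, for submodules \<open>B \<subseteq> Z\<close> of \<open>M\<close>.\<close>

definition subquotient ::
  "('k::field mpoly, 'm) gr_module \<Rightarrow> 'm set \<Rightarrow> 'm set \<Rightarrow> ('k mpoly, 'm set) gr_module" where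
  "subquotient M Z B = \<lparr>carrier = (\<lambda>x. B +>\<^bsub>M\<^esub> x) ` Z, mult = undefined, one = undefined,
     zero = B, add = (\<lambda>X Y. X <+>\<^bsub>M\<^esub> Y),
     smult = (\<lambda>p X. \<Union>x\<in>X. B +>\<^bsub>M\<^esub> (p \<odot>\<^bsub>M\<^esub> x)),
     hcomp = (\<lambda>d. (\<lambda>x. B +>\<^bsub>M\<^esub> x) ` (Z \<inter> hcomp M d))\<rparr>"


section \<open>Graded free modules, complexes and resolutions\<close>

text \<open>
  \<open>free_module n a\<close> is \<open>\<Oplus>\<^sub>i S(-a\<^sub>i)\<close>, where \<open>a\<close> is the list of the degrees of the generators.
  Its elements are the coefficient vectors, extended by \<open>0\<close>.
\<close>

definition free_module :: "nat \<Rightarrow> int list \<Rightarrow> ('k::field mpoly, nat \<Rightarrow> 'k mpoly) gr_module" where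
  "free_module n a = \<lparr>
     carrier = {v. (\<forall>i<length a. v i \<in> carrier (poly_ring n)) \<and> (\<forall>i\<ge>length a. v i = 0)},
     mult = undefined, one = undefined,
     zero = (\<lambda>i. 0), add = (\<lambda>v w i. v i + w i), smult = (\<lambda>p v i. p * v i),
     hcomp = (\<lambda>d. {v. (\<forall>i<length a. v i \<in> poly_comp n (d - a ! i)) \<and> (\<forall>i\<ge>length a. v i = 0)})\<rparr>"

text \<open>
  A complex \<open>E\<^sup>0 \<rightarrow> \<dots> \<rightarrow> E\<^sup>n\<close> is given by the degree lists \<open>e j\<close> and the differentials
  \<open>\<phi> j : E\<^sup>j \<rightarrow> E\<^sup>j\<^sup>+\<^sup>1\<close>, with \<open>E\<^sup>j = 0\<close> for \<open>j > n\<close>.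
\<close>

definition free_cocomplex ::
  "nat \<Rightarrow> (nat \<Rightarrow> int list) \<Rightarrow> (nat \<Rightarrow> (nat \<Rightarrow> 'k::field mpoly) \<Rightarrow> (nat \<Rightarrow> 'k mpoly)) \<Rightarrow> bool" where
  "free_cocomplex n e \<phi> \<longleftrightarrow>
     (\<forall>j>n. e j = []) \<and>
     (\<forall>j. graded_hom n (free_module n (e j)) (free_module n (e (Suc j))) (\<phi> j)) \<and>
     (\<forall>j. \<forall>x\<in>carrier (free_module n (e j)).
        \<phi> (Suc j) (\<phi> j x) = \<zero>\<^bsub>(free_module n (e (Suc (Suc j))) :: ('k mpoly, _) gr_module)\<^esub>)"

definition cohomology ::
  "nat \<Rightarrow> (nat \<Rightarrow> int list) \<Rightarrow> (nat \<Rightarrow> (nat \<Rightarrow> 'k::field mpoly) \<Rightarrow> (nat \<Rightarrow> 'k mpoly)) \<Rightarrow> nat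
     \<Rightarrow> ('k mpoly, (nat \<Rightarrow> 'k mpoly) set) gr_module" where
  "cohomology n e \<phi> j = subquotient (free_module n (e j))
     (a_kernel (free_module n (e j) :: ('k mpoly, _) gr_module)
               (free_module n (e (Suc j)) :: ('k mpoly, _) gr_module) (\<phi> j))
     (case j of 0 \<Rightarrow> {\<zero>\<^bsub>(free_module n (e 0) :: ('k mpoly, _) gr_module)\<^esub>}
              | Suc i \<Rightarrow> \<phi> i ` carrier (free_module n (e i)))"

text \<open>
  A graded free resolution \<open>0 \<leftarrow> M \<leftarrow> F\<^sub>0 \<leftarrow> F\<^sub>1 \<leftarrow> \<dots> \<leftarrow> F\<^sub>n \<leftarrow> 0\<close> is given by the degree lists \<open>f i\<close>,
  the differentials \<open>\<delta> i : F\<^sub>i\<^sub>+\<^sub>1 \<rightarrow> F\<^sub>i\<close> and the augmentation \<open>\<epsilon> : F\<^sub>0 \<rightarrow> M\<close>, with \<open>F\<^sub>i = 0\<close> for \<open>i > n\<close>.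
\<close>

definition free_resolution ::
  "nat \<Rightarrow> (nat \<Rightarrow> int list) \<Rightarrow> (nat \<Rightarrow> (nat \<Rightarrow> 'k::field mpoly) \<Rightarrow> (nat \<Rightarrow> 'k mpoly))
     \<Rightarrow> ((nat \<Rightarrow> 'k mpoly) \<Rightarrow> 'm) \<Rightarrow> ('k mpoly, 'm) gr_module \<Rightarrow> bool" where
  "free_resolution n f \<delta> \<epsilon> M \<longleftrightarrow>
     (\<forall>i>n. f i = []) \<and>
     graded_hom n (free_module n (f 0)) M \<epsilon> \<and>
     (\<forall>i. graded_hom n (free_module n (f (Suc i))) (free_module n (f i)) (\<delta> i)) \<and>
     \<epsilon> ` carrier (free_module n (f 0)) = carrier M \<and>
     a_kernel (free_module n (f 0) :: ('k mpoly, _) gr_module) M \<epsilon>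
       = \<delta> 0 ` carrier (free_module n (f (Suc 0))) \<and>
     (\<forall>i. a_kernel (free_module n (f (Suc i)) :: ('k mpoly, _) gr_module)
                   (free_module n (f i) :: ('k mpoly, _) gr_module) (\<delta> i)
          = \<delta> (Suc i) ` carrier (free_module n (f (Suc (Suc i)))))"


section \<open>Castelnuovo--Mumford regularity\<close>

text \<open>
  \<open>reg M = sup {k - i | Tor\<^sub>i(M,K)\<^sub>k \<noteq> 0}\<close>, where \<open>Tor\<^sub>i(M,K)\<close> is computed by the free resolution of
  \<open>K\<close> given by the Koszul complex on \<open>x\<^sub>1,\<dots>,x\<^sub>n\<close>. An element of degree \<open>k\<close> of \<open>M \<otimes> \<Lambda>\<^sup>iS(-1)\<^sup>n\<close> is written
  \<open>\<Sum>\<^sub>T u T \<otimes> e\<^sub>T\<close>, with \<open>T\<close> ranging over the \<open>i\<close>-subsets of the variables, and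
  \<open>\<partial>e\<^sub>T = \<Sum>\<^sub>v\<^sub>\<in>\<^sub>T (-1)\<^bsup>card {w\<in>T. w < v}\<^esup> x\<^sub>v e\<^bsub>T - {v}\<^esub>\<close>. The supremum is taken in the
  extended reals, so that \<open>reg 0 = -\<infinity>\<close>.
\<close>

definition koszul_chains ::
  "nat \<Rightarrow> ('k::field mpoly, 'm) gr_module \<Rightarrow> nat \<Rightarrow> int \<Rightarrow> (nat set \<Rightarrow> 'm) set" where
  "koszul_chains n M i k =
     {u. \<forall>T. if T \<subseteq> {..<n} \<and> card T = i then u T \<in> hcomp M (k - int i) else u T = \<zero>\<^bsub>M\<^esub>}"

definition koszul_diff ::
  "nat \<Rightarrow> ('k::field mpoly, 'm) gr_module \<Rightarrow> (nat set \<Rightarrow> 'm) \<Rightarrow> nat set \<Rightarrow> 'm" where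
  "koszul_diff n M u T =
     (if T \<subseteq> {..<n}
      then \<Oplus>\<^bsub>M\<^esub>v\<in>{..<n} - T.
             Poly_Mapping.single (Poly_Mapping.single v 1) ((-1) ^ card {w\<in>T. w < v})
               \<odot>\<^bsub>M\<^esub> u (insert v T)
      else \<zero>\<^bsub>M\<^esub>)"

definition tor_nonzero :: "nat \<Rightarrow> ('k::field mpoly, 'm) gr_module \<Rightarrow> nat \<Rightarrow> int \<Rightarrow> bool" where
  "tor_nonzero n M i k \<longleftrightarrow>
     {u \<in> koszul_chains n M i k. koszul_diff n M u = (\<lambda>T. \<zero>\<^bsub>M\<^esub>)}
       \<noteq> koszul_diff n M ` koszul_chains n M (Suc i) k"

definition cm_reg :: "nat \<Rightarrow> ('k::field mpoly, 'm) gr_module \<Rightarrow> ereal" where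
  "cm_reg n M = Sup {ereal (real_of_int (k - int i)) | i k. tor_nonzero n M i k}"


section \<open>The pairing\<close>

text \<open>The Betti number \<open>\<beta>\<^sub>i\<^sub>,\<^sub>k\<close> of \<open>F\<close> is the multiplicity of \<open>k\<close> in the degree list \<open>f i\<close>.\<close>

definition pairing ::
  "nat \<Rightarrow> (nat \<Rightarrow> int list) \<Rightarrow> (nat \<Rightarrow> int list)
     \<Rightarrow> (nat \<Rightarrow> (nat \<Rightarrow> 'k::field mpoly) \<Rightarrow> (nat \<Rightarrow> 'k mpoly)) \<Rightarrow> int" where
  "pairing n f e \<phi> = (\<Sum>j\<in>{0..n}. \<Sum>i\<in>{j..n}. \<Sum>k\<in>set (f i).
     (-1) ^ (i - j) * int (count_list (f i) k) * int (comp_dim (cohomology n e \<phi> j) (- k)))"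

end

theory Submission
  imports Defs "HOL-Library.Function_Algebras"
begin

text \<open>
  Let \<open>C i j\<close> be the degree \<open>0\<close> part of \<open>F\<^sub>i \<otimes> E\<^sup>j\<close>. These are finite-dimensional vector
  spaces, and they form a double complex whose differential in the direction of \<open>F\<close> is exact
  at every \<open>i > 0\<close>, because \<open>E\<^sup>j\<close> is free. Since \<open>F\<^sub>i\<close> is free,
  \<open>\<langle>F,E\<rangle> = \<Sum>\<^sub>i \<Sum>\<^sub>j\<^sub>\<le>\<^sub>i (-1)\<^bsup>i-j\<^esup> dim H\<^sup>j(C i \<bullet>)\<close>, where \<open>H\<^sup>j\<close> is taken in the direction of \<open>E\<close>.

  Rank-nullity along a row, cut off at the diagonal, turns the inner sum into the
  alternating sum of the \<open>dim (C i j)\<close>, \<open>j \<le> i\<close>, minus one rank. Exactness of the columns splits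
  \<open>dim (C i j)\<close> into the contributions of two successive syzygy modules of \<open>M\<close>, so the sum over
  \<open>i\<close> telescopes and only terms on the diagonal are left. They regroup as
  \<open>\<langle>F,E\<rangle> = \<Sum>\<^sub>i rank (H\<^sup>i(F\<^sub>i \<otimes> E)\<^sub>0 \<rightarrow> H\<^sup>i(M\<^sub>i \<otimes> E)\<^sub>0)\<close>,
  where \<open>M\<^sub>i\<close> is the \<open>i\<close>-th syzygy module of the resolution, \<open>M\<^sub>0 = M\<close>. This is the lemma
  \<open>total\<close>; its summands are nonnegative, which is the first assertion.

  For the second assertion one shows that all these ranks vanish. The first inequality on
  regularities gives \<open>(M \<otimes> E\<^sup>0)\<^sub>0 = 0\<close>, which is the case \<open>i = 0\<close>. The other ones give
  \<open>(F\<^sub>i \<otimes> H\<^bsup>i+1\<^esup>(E))\<^sub>0 = 0\<close> for every \<open>i\<close>. Under these two conditions, going down the diagonal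
  one can replace an element of \<open>C i i\<close> whose boundary lies in the syzygies by an element of the
  syzygies with the same boundary (lemma \<open>staircase\<close>); hence the image in \<open>M\<^sub>i\<^sub>+\<^sub>1 \<otimes> E\<close> of a cocycle on the diagonal is a
  boundary.

  Only two properties of the regularity enter. A generator of degree \<open>a\<close> of a free module \<open>G\<close>
  is a nonzero class in \<open>Tor\<^sub>0(G,K)\<^sub>a\<close>, so \<open>a \<le> reg G\<close>. In a module \<open>N\<close> of finite length the degrees
  of the nonzero homogeneous elements are bounded above, and a nonzero element of the largest degree \<open>m\<close> is
  annihilated by all variables; it therefore spans a nonzero class in \<open>Tor\<^sub>n(N,K)\<^bsub>m+n\<^esub>\<close>, so
  \<open>m \<le> reg N\<close>.
\<close>

section \<open>Dimensions of subspaces and rank-nullity\<close>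

text \<open>
  Subspaces of an ambient type are turned into records, because the dimension of a
  homogeneous component is a notion for vector spaces with an explicit carrier.
\<close>

definition space_of :: "('k::field \<Rightarrow> 'v \<Rightarrow> 'v) \<Rightarrow> 'v::ab_group_add set \<Rightarrow> ('k, 'v) module" where
  "space_of s V = \<lparr>carrier = V, mult = undefined, one = undefined, zero = 0, add = (+), smult = s\<rparr>"

lemma space_of_simps [simp]:
  "carrier (space_of s V) = V" "\<zero>\<^bsub>space_of s V\<^esub> = 0" "x \<oplus>\<^bsub>space_of s V\<^esub> y = x + y"
  "c \<odot>\<^bsub>space_of s V\<^esub> x = s c x"
  by (simp_all add: space_of_def)

definition fin_subspace :: "('k::field \<Rightarrow> 'v::ab_group_add \<Rightarrow> 'v) \<Rightarrow> 'v set \<Rightarrow> bool" where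
  "fin_subspace s V \<longleftrightarrow> Modules.module.subspace s V \<and> (\<exists>B. finite B \<and> V \<subseteq> Modules.module.span s B)"

definition vdim :: "('k::field \<Rightarrow> 'v::ab_group_add \<Rightarrow> 'v) \<Rightarrow> 'v set \<Rightarrow> nat" where
  "vdim s V = vectorspace.dim class_ring (space_of s V)"

context vector_space
begin

lemma vectorspace_space_of:
  assumes "local.subspace V"
  shows "vectorspace class_ring (space_of scale V)"
proof (rule vs_criteria)
  show "field (class_ring :: 'a ring)" by (rule class_field)
  show "\<forall>v\<in>carrier (space_of scale V). \<exists>w\<in>carrier (space_of scale V).
      v \<oplus>\<^bsub>space_of scale V\<^esub> w = \<zero>\<^bsub>space_of scale V\<^esub>"
  proof
    fix v assume "v \<in> carrier (space_of scale V)"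
    then show "\<exists>w\<in>carrier (space_of scale V). v \<oplus>\<^bsub>space_of scale V\<^esub> w = \<zero>\<^bsub>space_of scale V\<^esub>"
      using assms by (intro bexI[of _ "- v"]) (auto simp: subspace_neg)
  qed
qed (use assms in \<open>auto simp: subspace_0 subspace_add subspace_scale add_ac scale_left_distrib scale_right_distrib\<close>)

lemma finsum_space_of:
  assumes V: "local.subspace V" and g: "\<And>x. x \<in> A \<Longrightarrow> g x \<in> V"
  shows "finsum (space_of scale V) g A = sum g A"
proof -
  interpret W: vectorspace class_ring "space_of scale V"
    by (rule vectorspace_space_of[OF V])
  show ?thesis using g
    by (induction A rule: infinite_finite_induct) (auto simp: Pi_def W.finsum_insert)
qed

lemma fin_dim_space_of:
  assumes "fin_subspace scale V"
  shows "vectorspace.fin_dim class_ring (space_of scale V)"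
proof -
  have V: "local.subspace V" using assms by (simp add: fin_subspace_def)
  interpret W: vectorspace class_ring "space_of scale V"
    by (rule vectorspace_space_of[OF V])
  obtain B where B: "finite B" "V \<subseteq> local.span B" using assms by (auto simp: fin_subspace_def)
  obtain A where A: "A \<subseteq> V" "local.independent A" "V \<subseteq> local.span A"
    using basis_exists[of V] by metis
  have fin: "finite A"
    using independent_span_bound[OF B(1) A(2)] A(1) B(2) by auto
  have "W.span A = V"
  proof
    show "W.span A \<subseteq> V" using W.span_is_subset2[of A] A by simp
    show "V \<subseteq> W.span A"
    proof
      fix x assume "x \<in> V"
      then obtain u where u: "x = (\<Sum>a\<in>A. scale (u a) a)"
        using A(3) span_finite[OF fin] by auto
      have "x = W.lincomb u A"
        unfolding W.lincomb_def u using A(1)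
        by (subst finsum_space_of[OF V]) (auto intro: subspace_scale[OF V])
      then show "x \<in> W.span A"
        unfolding W.span_def using fin by auto
    qed
  qed
  then show ?thesis
    unfolding W.fin_dim_def using fin A(1) by (intro exI[of _ A]) auto
qed

lemma vdim_zero [simp]: "vdim scale {0} = 0"
proof -
  interpret W: vectorspace class_ring "space_of scale {0}"
    by (rule vectorspace_space_of) simp
  have "W.span {} = {0}" by (simp add: W.span_def W.lincomb_def)
  then show ?thesis
    unfolding vdim_def using W.gen_ge_dim[of "{}"] by simp
qed

lemma fin_subspace_mono: "fin_subspace scale V \<Longrightarrow> local.subspace U \<Longrightarrow> U \<subseteq> V \<Longrightarrow> fin_subspace scale U"
  unfolding fin_subspace_def by blast

lemma fin_subspace_zero: "fin_subspace scale {0}"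
  unfolding fin_subspace_def by (auto intro!: exI[of _ "{}"])

text \<open>
  The target is an arbitrary record so that the lemma applies to the projection of a
  homogeneous component onto a space of cosets.
\<close>

lemma rank_nullity_abstract:
  fixes W :: "('a, 'w, 'z) module_scheme"
  assumes V: "fin_subspace scale V" and W: "vectorspace class_ring W"
    and hom: "f \<in> LinearCombinations.module_hom class_ring (space_of scale V) W"
  shows "vdim scale V = vectorspace.dim class_ring (W\<lparr>carrier := f ` V\<rparr>) + vdim scale {x \<in> V. f x = \<zero>\<^bsub>W\<^esub>}"
proof -
  have sV: "local.subspace V" using V by (simp add: fin_subspace_def)
  interpret T: linear_map class_ring "space_of scale V" W f
    by (intro linear_map.intro mod_hom.intro mod_hom_axioms.intro hom W vectorspace_space_of[OF sV]
        vectorspace.axioms(1))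
  have "T.ker = {x \<in> V. f x = \<zero>\<^bsub>W\<^esub>}" by (simp add: T.ker_def)
  then have "T.V.vs T.ker = space_of scale {x \<in> V. f x = \<zero>\<^bsub>W\<^esub>}" by (simp add: space_of_def)
  then show ?thesis
    using T.rank_nullity[OF fin_dim_space_of[OF V]] by (simp add: T.im_def vdim_def)
qed

end

context vector_space_pair
begin

lemma rank_nullity_on:
  assumes V: "fin_subspace s1 V" and f: "Vector_Spaces.linear s1 s2 f"
  shows "fin_subspace s2 (f ` V)" "vdim s1 V = vdim s2 (f ` V) + vdim s1 {x \<in> V. f x = 0}"
    and "fin_subspace s1 {x \<in> V. f x = 0}"
proof -
  interpret f: Vector_Spaces.linear s1 s2 f by (rule f)
  have sV: "vs1.subspace V" using V by (simp add: fin_subspace_def)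
  have sI: "vs2.subspace (f ` V)" by (rule f.subspace_image[OF sV])
  obtain B where B: "finite B" "V \<subseteq> vs1.span B" using V by (auto simp: fin_subspace_def)
  have "f ` V \<subseteq> vs2.span (f ` B)" using B(2) f.span_image[of B] by auto
  then show "fin_subspace s2 (f ` V)"
    unfolding fin_subspace_def using sI B(1) by blast
  have "f \<in> LinearCombinations.module_hom class_ring (space_of s1 V) (space_of s2 (f ` V))"
    by (auto simp: LinearCombinations.module_hom_def f.add f.scale)
  from vs1.rank_nullity_abstract[OF V vs2.vectorspace_space_of[OF sI] this]
  show "vdim s1 V = vdim s2 (f ` V) + vdim s1 {x \<in> V. f x = 0}"
    by (simp add: vdim_def space_of_def)
  show "fin_subspace s1 {x \<in> V. f x = 0}"
    using sV by (intro vs1.fin_subspace_mono[OF V])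
      (auto simp: vs1.subspace_def f.add f.scale f.zero)
qed

end

context vector_space
begin

lemma vdim_mono:
  assumes V: "fin_subspace scale V" and U: "local.subspace U" "U \<subseteq> V"
  shows "vdim scale U \<le> vdim scale V"
proof -
  have sV: "local.subspace V" using V by (simp add: fin_subspace_def)
  interpret V: vectorspace class_ring "space_of scale V" by (rule vectorspace_space_of[OF sV])
  interpret U: vectorspace class_ring "space_of scale U" by (rule vectorspace_space_of[OF U(1)])
  have fU: "fin_subspace scale U" by (rule fin_subspace_mono[OF V U])
  obtain A where A: "finite A" "U.basis A"
    using U.finite_basis_exists[OF fin_dim_space_of[OF fU]] by blast
  have sub: "submodule class_ring U (space_of scale V)"
    by (rule submodule.intro) (use U in \<open>auto intro: local.subspace_add subspace_scale subspace_0 V.module_axioms\<close>)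
  have "U.lin_indpt A" "A \<subseteq> U" using A by (auto simp: U.basis_def)
  moreover have "space_of scale U = V.md U" by (simp add: space_of_def)
  ultimately have "V.lin_indpt A"
    using V.span_li_not_depend(2)[OF _ sub, of A] by simp
  then have "card A \<le> V.dim"
    using V.li_le_dim[OF fin_dim_space_of[OF V], of A] \<open>A \<subseteq> U\<close> U(2) by simp
  moreover have "U.dim = card A" by (rule U.dim_basis[OF A])
  ultimately show ?thesis by (simp add: vdim_def)
qed

end

section \<open>Double complexes with exact columns\<close>

text \<open>
  The row \<open>C i \<bullet>\<close> has the differentials \<open>d\<close>, the column \<open>C \<bullet> j\<close> the differentials \<open>b\<close>. The two
  differentials commute, and columns are exact except at \<open>i = 0\<close>. The maps are linear on
  the whole ambient space, which spares the bookkeeping of domains.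
\<close>

locale double_complex = vector_space s
  for s :: "'k::field \<Rightarrow> 'v::ab_group_add \<Rightarrow> 'v" +
  fixes n :: nat and C :: "nat \<Rightarrow> nat \<Rightarrow> 'v set" and d b :: "nat \<Rightarrow> 'v \<Rightarrow> 'v"
  assumes fin: "fin_subspace s (C i j)"
    and lin_d: "Vector_Spaces.linear s s (d j)"
    and lin_b: "Vector_Spaces.linear s s (b i)"
    and d_in: "u \<in> C i j \<Longrightarrow> d j u \<in> C i (Suc j)"
    and b_in: "u \<in> C (Suc i) j \<Longrightarrow> b i u \<in> C i j"
    and dd: "u \<in> C i j \<Longrightarrow> d (Suc j) (d j u) = 0"
    and exact: "{u \<in> C (Suc i) j. b i u = 0} = b (Suc i) ` C (Suc (Suc i)) j"
    and comm: "d j (b i u) = b i (d j u)"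
    and bound: "i > n \<Longrightarrow> C i j = {0}"
begin

sublocale pair: vector_space_pair s s ..

lemma linear_simps:
  "d j (x + y) = d j x + d j y" "b i (x + y) = b i x + b i y"
  "d j (x - y) = d j x - d j y" "b i (x - y) = b i x - b i y"
  "d j 0 = 0" "b i 0 = 0" "d j (s c x) = s c (d j x)" "b i (s c x) = s c (b i x)"
proof -
  interpret d: Vector_Spaces.linear s s "d j" by (rule lin_d)
  interpret b: Vector_Spaces.linear s s "b i" by (rule lin_b)
  show "d j (x + y) = d j x + d j y" "b i (x + y) = b i x + b i y"
    "d j (x - y) = d j x - d j y" "b i (x - y) = b i x - b i y"
    "d j 0 = 0" "b i 0 = 0" "d j (s c x) = s c (d j x)" "b i (s c x) = s c (b i x)"
    by (rule d.add b.add d.diff b.diff d.zero b.zero d.scale b.scale)+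
qed

lemma sub: "local.subspace (C i j)"
  using fin by (simp add: fin_subspace_def)

definition cocycles :: "nat \<Rightarrow> nat \<Rightarrow> 'v set" where
  "cocycles i j = {u \<in> C i j. d j u = 0}"

text \<open>
  In a column that resolves a module tensored with a free one, \<open>syz i j\<close> is the part of
  \<open>C i j\<close> that comes from the \<open>(i+1)\<close>-st syzygy module.
\<close>

definition syz :: "nat \<Rightarrow> nat \<Rightarrow> 'v set" where
  "syz i j = b i ` C (Suc i) j"

definition coh_dim :: "nat \<Rightarrow> nat \<Rightarrow> int" where
  "coh_dim i j = int (vdim s (cocycles i j))
     - (case j of 0 \<Rightarrow> 0 | Suc l \<Rightarrow> int (vdim s (d l ` C i l)))"

lemma fin_cocycles: "fin_subspace s (cocycles i j)"
  unfolding cocycles_def by (rule pair.rank_nullity_on(3)[OF fin lin_d])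

lemma fin_syz: "fin_subspace s (syz i j)"
  unfolding syz_def by (rule pair.rank_nullity_on(1)[OF fin lin_b])

lemma syz_subset: "syz i j \<subseteq> C i j"
  unfolding syz_def using b_in by auto

lemma syz_Suc: "syz (Suc i) j = {u \<in> C (Suc i) j. b i u = 0}"
  unfolding syz_def using exact by simp

lemma row_rank_nullity: "vdim s (C i j) = vdim s (d j ` C i j) + vdim s (cocycles i j)"
  unfolding cocycles_def by (rule pair.rank_nullity_on(2)[OF fin lin_d])

text \<open>
  Replace the dimension of each cohomology space by the dimension of the space minus the
  ranks of the two adjacent differentials. All ranks cancel in pairs except the last
  one, whose partner is beyond the cut-off.
\<close>

lemma truncated_euler:
  "(\<Sum>j\<le>m. (- 1) ^ (m - j) * coh_dim i j)
     = (\<Sum>j\<le>m. (- 1) ^ (m - j) * int (vdim s (C i j))) - int (vdim s (d m ` C i m))"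
proof (induction m)
  case 0
  show ?case using row_rank_nullity[of i 0] by (simp add: coh_dim_def)
next
  case (Suc m)
  have flip: "(\<Sum>j\<le>m. (- 1) ^ (Suc m - j) * g j) = - (\<Sum>j\<le>m. (- 1) ^ (m - j) * g j)"
    for g :: "nat \<Rightarrow> int"
    by (simp add: Suc_diff_le sum_negf[symmetric])
  show ?case
    using Suc row_rank_nullity[of i "Suc m"] by (simp add: flip coh_dim_def)
qed

text \<open>
  For \<open>i > 0\<close>, \<open>pushed i\<close> is the dimension of the image of the cocycles of \<open>C i i\<close> in the
  syzygies; for \<open>i = 0\<close> the target would be the cokernel of \<open>b 0\<close>, so that the image is a
  quotient. By commutation \<open>hit i\<close> counts those elements in the image for \<open>i + 1\<close> that come
  from boundaries.
\<close>

definition pushed :: "nat \<Rightarrow> nat" where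
  "pushed i = (case i of 0 \<Rightarrow> vdim s (cocycles 0 0) - vdim s (cocycles 0 0 \<inter> syz 0 0)
     | Suc l \<Rightarrow> vdim s (b l ` cocycles i i))"

definition hit :: "nat \<Rightarrow> nat" where
  "hit i = vdim s (d i ` syz i i)"

definition syz_euler :: "nat \<Rightarrow> int" where
  "syz_euler i = (\<Sum>j\<le>i. (- 1) ^ (i - j) * int (vdim s (syz i j)))"

lemma syz_split:
  "vdim s (syz i i) = hit i + vdim s (cocycles i i \<inter> syz i i)"
proof -
  have "{x \<in> syz i i. d i x = 0} = cocycles i i \<inter> syz i i"
    using syz_subset unfolding cocycles_def by auto
  then show ?thesis
    using pair.rank_nullity_on(2)[OF fin_syz lin_d, of i i i] by (simp add: hit_def)
qed

lemma row_euler_0: "(\<Sum>j\<le>0. (- 1) ^ (0 - j) * coh_dim 0 j) = int (pushed 0) - int (hit 0) + syz_euler 0"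
proof -
  have "vdim s (cocycles 0 0 \<inter> syz 0 0) \<le> vdim s (cocycles 0 0)"
    using fin_cocycles[of 0 0] fin_syz[of 0 0]
    by (intro vdim_mono[OF fin_cocycles]) (auto simp: fin_subspace_def intro: subspace_inter)
  then show ?thesis
    using syz_split[of 0] by (simp add: coh_dim_def pushed_def syz_euler_def)
qed

text \<open>
  The dimensions in the row \<open>i + 1\<close> split into those of \<open>syz i\<close> and \<open>syz (i+1)\<close>. The remaining
  rank at the diagonal is computed by restricting \<open>d\<close> to \<open>syz (i+1)\<close> and \<open>b\<close> to the cocycles.
\<close>

lemma row_euler_Suc:
  "(\<Sum>j\<le>Suc i. (- 1) ^ (Suc i - j) * coh_dim (Suc i) j)
     = int (pushed (Suc i)) - int (hit (Suc i)) + syz_euler (Suc i) - syz_euler i"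
proof -
  have split: "int (vdim s (C (Suc i) j)) = int (vdim s (syz i j)) + int (vdim s (syz (Suc i) j))" for j
    using pair.rank_nullity_on(2)[OF fin lin_b, of "Suc i" j i] unfolding syz_Suc
    by (simp add: syz_def)
  have flip: "(\<Sum>j\<le>i. (- 1) ^ (Suc i - j) * g j) = - (\<Sum>j\<le>i. (- 1) ^ (i - j) * g j)"
    for g :: "nat \<Rightarrow> int"
    by (simp add: Suc_diff_le sum_negf[symmetric])
  have e: "(\<Sum>j\<le>Suc i. (- 1) ^ (Suc i - j) * int (vdim s (C (Suc i) j)))
      = syz_euler (Suc i) - syz_euler i + int (vdim s (syz i (Suc i)))"
    unfolding split ring_distribs sum.distrib
    by (simp add: syz_euler_def flip)
  have z: "vdim s (cocycles (Suc i) (Suc i)) = pushed (Suc i) + vdim s (cocycles (Suc i) (Suc i) \<inter> syz (Suc i) (Suc i))"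
  proof -
    have "{x \<in> cocycles (Suc i) (Suc i). b i x = 0} = cocycles (Suc i) (Suc i) \<inter> syz (Suc i) (Suc i)"
      unfolding cocycles_def syz_Suc by auto
    then show ?thesis
      using pair.rank_nullity_on(2)[OF fin_cocycles lin_b, of "Suc i" "Suc i" i] by (simp add: pushed_def)
  qed
  show ?thesis
    unfolding truncated_euler e using z row_rank_nullity[of "Suc i" "Suc i"] split[of "Suc i"] syz_split[of "Suc i"] by simp
qed

lemma total_partial:
  "(\<Sum>i\<le>m. \<Sum>j\<le>i. (- 1) ^ (i - j) * coh_dim i j)
     = int (pushed 0) + (\<Sum>i<m. int (pushed (Suc i)) - int (hit i)) - int (hit m) + syz_euler m"
proof (induction m)
  case 0
  then show ?case using row_euler_0 by simp
next
  case (Suc m)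
  have "(\<Sum>i\<le>Suc m. \<Sum>j\<le>i. (- 1) ^ (i - j) * coh_dim i j)
    = (\<Sum>i\<le>m. \<Sum>j\<le>i. (- 1) ^ (i - j) * coh_dim i j) + (\<Sum>j\<le>Suc m. (- 1) ^ (Suc m - j) * coh_dim (Suc m) j)"
    by (rule sum.atMost_Suc)
  then show ?case unfolding Suc row_euler_Suc by simp
qed

text \<open>
  By \<open>d_syz_subset\<close> below, the summand with index \<open>i\<close> is the rank of the map induced by \<open>b i\<close> from
  the cohomology of the row \<open>i + 1\<close>, at the diagonal, to the cohomology of \<open>syz i\<close>.
\<close>

lemma total:
  "(\<Sum>i\<le>n. \<Sum>j\<le>i. (- 1) ^ (i - j) * coh_dim i j)
     = int (pushed 0) + (\<Sum>i<n. int (pushed (Suc i)) - int (hit i))"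
proof -
  have "syz n j = {0}" for j
    unfolding syz_def using bound[of "Suc n" j] by (simp add: linear_simps)
  then show ?thesis unfolding total_partial by (simp add: hit_def syz_euler_def linear_simps)
qed

lemma d_syz_subset: "d i ` syz i i \<subseteq> b i ` cocycles (Suc i) (Suc i)"
  unfolding syz_def cocycles_def using d_in dd by (auto simp: comm)

lemma hit_le: "hit i \<le> pushed (Suc i)"
  unfolding hit_def pushed_def nat.case
  by (intro vdim_mono pair.rank_nullity_on(1)[OF fin_cocycles lin_b] d_syz_subset)
    (use pair.rank_nullity_on(1)[OF fin_syz lin_d] in \<open>auto simp: fin_subspace_def\<close>)

theorem total_nonneg: "(\<Sum>i\<le>n. \<Sum>j\<le>i. (- 1) ^ (i - j) * coh_dim i j) \<ge> 0"
  unfolding total using hit_le by (intro add_nonneg_nonneg sum_nonneg) (auto simp del: of_nat_diff)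

text \<open>
  Induction along the diagonal. If \<open>d w\<close> lies in the syzygies, then \<open>b w\<close> is a cocycle in the
  previous row, hence a boundary \<open>d v\<close>. By induction \<open>v\<close> may be taken of the form \<open>b y\<close>, and then
  \<open>w - d y\<close> is the required element.
\<close>

lemma staircase:
  assumes start: "C 0 0 \<subseteq> syz 0 0" and acyclic: "\<And>i. cocycles i (Suc i) \<subseteq> d i ` C i i"
  shows "w \<in> C i i \<Longrightarrow> d i w \<in> syz i (Suc i) \<Longrightarrow> \<exists>w'\<in>syz i i. d i w' = d i w"
proof (induction i arbitrary: w)
  case 0
  then show ?case using start by auto
next
  case (Suc i)
  have bw: "b i w \<in> C i (Suc i)" using Suc.prems(1) by (rule b_in)
  have bd: "b i (d (Suc i) w) = 0" using Suc.prems(2) by (simp add: syz_Suc)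
  then have "d (Suc i) (b i w) = 0" by (simp add: comm)
  with bw obtain v where v: "v \<in> C i i" "b i w = d i v"
    using acyclic[of i] unfolding cocycles_def by auto
  have "d i v \<in> syz i (Suc i)" unfolding v(2)[symmetric] syz_def using Suc.prems(1) by blast
  from Suc.IH[OF v(1) this] obtain y where y: "y \<in> C (Suc i) i" "d i (b i y) = d i v"
    unfolding syz_def by auto
  define w' where "w' = w - d i y"
  have "w' \<in> C (Suc i) (Suc i)"
    unfolding w'_def using Suc.prems(1) d_in[OF y(1)] by (rule subspace_diff[OF sub])
  moreover have "b i w' = 0" using v(2) y(2) by (simp add: w'_def linear_simps comm)
  moreover have "d (Suc i) w' = d (Suc i) w" using dd[OF y(1)] by (simp add: w'_def linear_simps)
  ultimately show ?case unfolding syz_Suc by blast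
qed

text \<open>
  The second hypothesis is the vanishing of the cohomology of every row one step to the right of
  the diagonal. By the staircase lemma every image of a diagonal cocycle is then a boundary of
  syzygies, and all summands of the total vanish.
\<close>

theorem total_zero:
  assumes start: "C 0 0 \<subseteq> syz 0 0" and acyclic: "\<And>i. cocycles i (Suc i) \<subseteq> d i ` C i i"
  shows "(\<Sum>i\<le>n. \<Sum>j\<le>i. (- 1) ^ (i - j) * coh_dim i j) = 0"
proof -
  have "b i ` cocycles (Suc i) (Suc i) \<subseteq> d i ` syz i i" for i
  proof
    fix x assume "x \<in> b i ` cocycles (Suc i) (Suc i)"
    then obtain z where z: "z \<in> C (Suc i) (Suc i)" "d (Suc i) z = 0" "x = b i z"
      by (auto simp: cocycles_def)
    then have "x \<in> cocycles i (Suc i)"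
      using b_in by (simp add: cocycles_def comm linear_simps)
    then obtain w where w: "w \<in> C i i" "x = d i w" using acyclic[of i] by auto
    moreover have "x \<in> syz i (Suc i)" using z by (auto simp: syz_def)
    ultimately show "x \<in> d i ` syz i i"
      using staircase[OF start acyclic, of w i] by (metis image_eqI)
  qed
  then have "b i ` cocycles (Suc i) (Suc i) = d i ` syz i i" for i
    using d_syz_subset by (rule subset_antisym)
  then have "pushed (Suc i) = hit i" for i by (simp add: pushed_def hit_def)
  moreover have "cocycles 0 0 \<inter> syz 0 0 = cocycles 0 0"
    using start by (auto simp: cocycles_def)
  then have "pushed 0 = 0" by (simp add: pushed_def)
  ultimately show ?thesis unfolding total by simp
qed

end

section \<open>Polynomials and their homogeneous parts\<close>

lemma polys_iff: "p \<in> carrier (poly_ring n) \<longleftrightarrow> (\<forall>m\<in>Poly_Mapping.keys p. Poly_Mapping.keys m \<subseteq> {..<n})"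
  by (simp add: poly_ring_def)

lemma poly_ring_simps [simp]:
  "\<zero>\<^bsub>poly_ring n\<^esub> = 0" "\<one>\<^bsub>poly_ring n\<^esub> = 1"
  "p \<oplus>\<^bsub>poly_ring n\<^esub> q = p + q" "p \<otimes>\<^bsub>poly_ring n\<^esub> q = p * q"
  by (simp_all add: poly_ring_def)

lemma keys_add_nat: "Poly_Mapping.keys (a + b) = Poly_Mapping.keys a \<union> Poly_Mapping.keys (b :: nat \<Rightarrow>\<^sub>0 nat)"
  by (auto simp: in_keys_iff lookup_add)

lemma polys_closed [simp, intro]:
  "0 \<in> carrier (poly_ring n)" "1 \<in> carrier (poly_ring n)"
  "p \<in> carrier (poly_ring n) \<Longrightarrow> q \<in> carrier (poly_ring n) \<Longrightarrow> p + q \<in> carrier (poly_ring n)"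
  "p \<in> carrier (poly_ring n) \<Longrightarrow> q \<in> carrier (poly_ring n) \<Longrightarrow> p * q \<in> carrier (poly_ring n)"
  "p \<in> carrier (poly_ring n) \<Longrightarrow> - p \<in> carrier (poly_ring n)"
  "Poly_Mapping.single 0 c \<in> carrier (poly_ring n)"
proof -
  show "p \<in> carrier (poly_ring n) \<Longrightarrow> q \<in> carrier (poly_ring n) \<Longrightarrow> p + q \<in> carrier (poly_ring n)"
    unfolding polys_iff using Poly_Mapping.keys_add[of p q] by blast
  show "p \<in> carrier (poly_ring n) \<Longrightarrow> q \<in> carrier (poly_ring n) \<Longrightarrow> p * q \<in> carrier (poly_ring n)"
    unfolding polys_iff using keys_mult[of p q] by (fastforce simp: keys_add_nat)
qed (auto simp: polys_iff)

lemma polys_sum [intro]: "(\<And>x. x \<in> A \<Longrightarrow> g x \<in> carrier (poly_ring n)) \<Longrightarrow> sum g A \<in> carrier (poly_ring n)"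
  by (induction A rule: infinite_finite_induct) auto

lemma cring_poly_ring: "cring (poly_ring n :: 'k::field mpoly ring)" (is "cring ?R")
proof (rule cringI)
  show "abelian_group ?R"
  proof (rule abelian_groupI)
    fix x assume "x \<in> carrier ?R"
    then show "\<exists>y\<in>carrier ?R. y \<oplus>\<^bsub>?R\<^esub> x = \<zero>\<^bsub>?R\<^esub>"
      by (intro bexI[of _ "- x"]) auto
  qed (auto simp: add_ac)
  show "Group.comm_monoid ?R"
    by (rule comm_monoidI) (auto simp: mult_ac)
qed (auto simp: distrib_right)

lemma mon_degree_add: "mon_degree (a + b) = mon_degree a + mon_degree b"
proof -
  have *: "mon_degree m = (\<Sum>v\<in>Poly_Mapping.keys a \<union> Poly_Mapping.keys b. Poly_Mapping.lookup m v)"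
    if "Poly_Mapping.keys m \<subseteq> Poly_Mapping.keys a \<union> Poly_Mapping.keys b" for m
    unfolding mon_degree_def using that by (intro sum.mono_neutral_left) (auto simp: in_keys_iff)
  show ?thesis
    unfolding *[of "a + b", OF eq_refl[OF keys_add_nat]] *[of a, OF Un_upper1] *[of b, OF Un_upper2]
    by (simp add: lookup_add sum.distrib)
qed

lemma poly_comp_iff:
  "p \<in> poly_comp n d \<longleftrightarrow> p \<in> carrier (poly_ring n) \<and> (\<forall>m\<in>Poly_Mapping.keys p. int (mon_degree m) = d)"
  by (simp add: poly_comp_def)

lemma poly_comp_closed [simp, intro]:
  "0 \<in> poly_comp n d"
  "p \<in> poly_comp n d \<Longrightarrow> q \<in> poly_comp n d \<Longrightarrow> p + q \<in> poly_comp n d"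
  "p \<in> poly_comp n d \<Longrightarrow> - p \<in> poly_comp n d"
  "Poly_Mapping.single 0 c \<in> poly_comp n 0"
proof -
  show "p \<in> poly_comp n d \<Longrightarrow> q \<in> poly_comp n d \<Longrightarrow> p + q \<in> poly_comp n d"
    unfolding poly_comp_iff using Poly_Mapping.keys_add[of p q] by blast
qed (auto simp: poly_comp_iff mon_degree_def)

lemma poly_comp_mult:
  assumes "p \<in> poly_comp n c" "q \<in> poly_comp n d"
  shows "p * q \<in> poly_comp n (c + d)"
proof -
  have "int (mon_degree m) = c + d" if m: "m \<in> Poly_Mapping.keys (p * q)" for m
  proof -
    obtain a b where "m = a + b" "a \<in> Poly_Mapping.keys p" "b \<in> Poly_Mapping.keys q"
      using m keys_mult[of p q] by blast
    then show ?thesis using assms by (auto simp: poly_comp_iff mon_degree_add)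
  qed
  then show ?thesis using assms by (auto simp: poly_comp_iff)
qed

lemma poly_comp_scale [intro]:
  "p \<in> poly_comp n d \<Longrightarrow> Poly_Mapping.single 0 c * p \<in> poly_comp n d"
  using poly_comp_mult[of "Poly_Mapping.single 0 c" n 0 p d] by simp

lemma poly_comp_polys: "p \<in> poly_comp n d \<Longrightarrow> p \<in> carrier (poly_ring n)"
  by (simp add: poly_comp_def)

definition hpart :: "int \<Rightarrow> 'k::field mpoly \<Rightarrow> 'k mpoly" where
  "hpart d p = Abs_poly_mapping (\<lambda>m. if int (mon_degree m) = d then Poly_Mapping.lookup p m else 0)"

lemma lookup_hpart:
  "Poly_Mapping.lookup (hpart d p) m = (if int (mon_degree m) = d then Poly_Mapping.lookup p m else 0)"
proof -
  have "finite {m. (if int (mon_degree m) = d then Poly_Mapping.lookup p m else 0) \<noteq> 0}"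
    by (rule finite_subset[OF _ finite_keys[of p]]) (auto simp: in_keys_iff)
  then show ?thesis unfolding hpart_def by simp
qed

lemma keys_hpart: "Poly_Mapping.keys (hpart d p) = {m \<in> Poly_Mapping.keys p. int (mon_degree m) = d}"
  by (auto simp: in_keys_iff lookup_hpart split: if_splits)

lemma hpart_add: "hpart d (p + q) = hpart d p + hpart d q"
  by (rule poly_mapping_eqI) (simp add: lookup_hpart lookup_add)

lemma hpart_zero [simp]: "hpart d 0 = 0"
  by (rule poly_mapping_eqI) (simp add: lookup_hpart)

lemma hpart_sum: "hpart d (sum g A) = (\<Sum>x\<in>A. hpart d (g x))"
  by (induction A rule: infinite_finite_induct) (simp_all add: hpart_add)

lemma hpart_in: "p \<in> carrier (poly_ring n) \<Longrightarrow> hpart d p \<in> poly_comp n d"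
  by (auto simp: poly_comp_iff polys_iff keys_hpart)

lemma hpart_homogeneous: "p \<in> poly_comp n c \<Longrightarrow> hpart d p = (if c = d then p else 0)"
  by (rule poly_mapping_eqI) (auto simp: lookup_hpart poly_comp_iff in_keys_iff)

lemma sum_hpart:
  assumes "finite D" "\<And>m. m \<in> Poly_Mapping.keys p \<Longrightarrow> int (mon_degree m) \<in> D"
  shows "(\<Sum>d\<in>D. hpart d p) = p"
proof (rule poly_mapping_eqI)
  fix m
  show "Poly_Mapping.lookup (\<Sum>d\<in>D. hpart d p) m = Poly_Mapping.lookup p m"
    using assms by (auto simp: lookup_sum lookup_hpart in_keys_iff)
qed

lemma finite_monomials: "finite {m. Poly_Mapping.keys m \<subseteq> {..<n} \<and> int (mon_degree m) = d}"
proof (rule inj_on_finite)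
  let ?S = "{m. Poly_Mapping.keys m \<subseteq> {..<n} \<and> int (mon_degree m) = d}"
  show "inj_on Poly_Mapping.lookup ?S" by (rule inj_onI, rule poly_mapping_eqI, simp)
  show "finite {g. \<forall>v. (v \<in> {..<n} \<longrightarrow> g v \<in> {..nat d}) \<and> (v \<notin> {..<n} \<longrightarrow> g v = 0)}"
    by (rule finite_set_of_finite_funs) auto
  show "Poly_Mapping.lookup ` ?S \<subseteq> {g. \<forall>v. (v \<in> {..<n} \<longrightarrow> g v \<in> {..nat d}) \<and> (v \<notin> {..<n} \<longrightarrow> g v = 0)}"
  proof (rule image_subsetI)
    fix m assume m: "m \<in> ?S"
    have "Poly_Mapping.lookup m v \<le> nat d" for v
      using m member_le_sum[of v "Poly_Mapping.keys m" "Poly_Mapping.lookup m"]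
      by (cases "v \<in> Poly_Mapping.keys m")
        (auto simp: mon_degree_def in_keys_iff nat_le_iff simp del: of_nat_sum)
    then show "Poly_Mapping.lookup m \<in> {g. \<forall>v. (v \<in> {..<n} \<longrightarrow> g v \<in> {..nat d}) \<and> (v \<notin> {..<n} \<longrightarrow> g v = 0)}"
      using m by (auto simp: in_keys_iff)
  qed
qed

abbreviation scale0 :: "'k::field \<Rightarrow> 'k mpoly \<Rightarrow> 'k mpoly" where
  "scale0 c p \<equiv> Poly_Mapping.single 0 c * p"

lemma vector_space_pointwise:
  assumes "vector_space s"
  shows "vector_space (\<lambda>c u i. s c (u i))"
proof -
  interpret vector_space s by fact
  show ?thesis by unfold_locales (auto simp: fun_eq_iff scale_right_distrib scale_left_distrib)
qed

lemma vector_space_scale0: "vector_space scale0"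
  by unfold_locales
    (simp_all add: distrib_left single_add distrib_right mult.assoc[symmetric] mult_single single_one)

lemma mpoly_expand: "p = (\<Sum>m\<in>Poly_Mapping.keys p. scale0 (Poly_Mapping.lookup p m) (Poly_Mapping.single m (1::'k::field)))"
proof (rule poly_mapping_eqI)
  fix m
  show "Poly_Mapping.lookup p m = Poly_Mapping.lookup (\<Sum>m\<in>Poly_Mapping.keys p. scale0 (Poly_Mapping.lookup p m) (Poly_Mapping.single m 1)) m"
    by (auto simp: lookup_sum mult_single lookup_single when_def in_keys_iff)
qed

lemma fin_subspace_poly_comp: "fin_subspace scale0 (poly_comp n d :: 'k::field mpoly set)"
proof -
  interpret vector_space scale0 by (rule vector_space_scale0)
  let ?B = "(\<lambda>m. Poly_Mapping.single m 1) ` {m. Poly_Mapping.keys m \<subseteq> {..<n} \<and> int (mon_degree m) = d}"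
  have "(poly_comp n d :: 'k mpoly set) \<subseteq> local.span ?B"
  proof
    fix p :: "'k mpoly" assume p: "p \<in> poly_comp n d"
    show "p \<in> local.span ?B"
      by (subst mpoly_expand[of p], rule span_sum, rule span_scale, rule span_base)
        (use p in \<open>auto simp: poly_comp_iff polys_iff\<close>)
  qed
  moreover have "local.subspace (poly_comp n d :: 'k mpoly set)" by (auto simp: subspace_def)
  ultimately show ?thesis
    unfolding fin_subspace_def
    by (intro conjI exI[of _ ?B] finite_imageI finite_monomials)
qed

section \<open>Direct sums of subspaces\<close>

text \<open>
  This is the external direct sum of \<open>V 0, \<dots>, V (m - 1)\<close>, with vectors extended by \<open>0\<close>.
\<close>

definition blocks :: "nat \<Rightarrow> (nat \<Rightarrow> 'v::zero set) \<Rightarrow> (nat \<Rightarrow> 'v) set" where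
  "blocks m V = {u. (\<forall>p<m. u p \<in> V p) \<and> (\<forall>p\<ge>m. u p = 0)}"

text \<open>
  Induction on the number of summands: the projection to the last one has the sum of the
  other ones as its kernel.
\<close>

lemma fin_subspace_blocks:
  assumes s: "vector_space s" and V: "\<And>p. p < m \<Longrightarrow> fin_subspace s (V p)"
  shows "fin_subspace (\<lambda>c u p. s c (u p)) (blocks m V)"
    and "vdim (\<lambda>c u p. s c (u p)) (blocks m V) = (\<Sum>p<m. vdim s (V p))"
proof -
  define S where "S = (\<lambda>c u (p::nat). s c (u p))"
  interpret s: vector_space s by fact
  interpret S: vector_space S unfolding S_def by (rule vector_space_pointwise[OF s])
  interpret pair: vector_space_pair S s ..
  interpret emb: vector_space_pair s S ..
  have lin: "Vector_Spaces.linear S s (\<lambda>u. u m)" for m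
    by unfold_locales (auto simp: S_def)
  have lin': "Vector_Spaces.linear s S (\<lambda>v p. if p = m then v else 0)" for m
    by unfold_locales (auto simp: S_def fun_eq_iff)
  have "fin_subspace S (blocks m V) \<and> vdim S (blocks m V) = (\<Sum>p<m. vdim s (V p))"
    using V
  proof (induction m)
    case 0
    have "blocks 0 V = {0}" by (auto simp: blocks_def)
    then show ?case using S.fin_subspace_zero by simp
  next
    case (Suc m)
    let ?e = "\<lambda>v p. if p = m then v else 0"
    have IH: "fin_subspace S (blocks m V)" "vdim S (blocks m V) = (\<Sum>p<m. vdim s (V p))"
      using Suc by auto
    obtain B where B: "finite B" "blocks m V \<subseteq> S.span B"
      using IH(1) by (auto simp: fin_subspace_def)
    obtain B' where B': "finite B'" "V m \<subseteq> s.span B'"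
      using Suc.prems[of m] by (auto simp: fin_subspace_def)
    interpret e: Vector_Spaces.linear s S ?e by (rule lin')
    have sub: "S.subspace (blocks (Suc m) V)"
      using Suc.prems unfolding S.subspace_def
      by (auto simp: s.subspace_def blocks_def fin_subspace_def S_def)
    have "blocks (Suc m) V \<subseteq> S.span (B \<union> ?e ` B')"
    proof
      fix u assume u: "u \<in> blocks (Suc m) V"
      have "u(m := 0) \<in> blocks m V" using u by (auto simp: blocks_def)
      then have "u(m := 0) \<in> S.span (B \<union> ?e ` B')"
        using B(2) S.span_mono[of B "B \<union> ?e ` B'"] by auto
      moreover have "u m \<in> s.span B'" using u B'(2) by (auto simp: blocks_def)
      then have "?e (u m) \<in> S.span (B \<union> ?e ` B')"
        using e.span_image[of B'] S.span_mono[of "?e ` B'" "B \<union> ?e ` B'"] by auto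
      moreover have "u = u(m := 0) + ?e (u m)" by (auto simp: fun_eq_iff)
      ultimately show "u \<in> S.span (B \<union> ?e ` B')" using S.span_add by metis
    qed
    then have fs: "fin_subspace S (blocks (Suc m) V)"
      unfolding fin_subspace_def using sub B(1) B'(1)
      by (intro conjI exI[of _ "B \<union> ?e ` B'"]) simp_all
    have z: "0 \<in> V p" if "p \<le> m" for p
      using Suc.prems[of p] that by (auto simp: fin_subspace_def s.subspace_def)
    have im: "(\<lambda>u. u m) ` blocks (Suc m) V = V m"
    proof (intro equalityI subsetI)
      fix v assume v: "v \<in> V m"
      have "?e v \<in> blocks (Suc m) V" using z v by (auto simp: blocks_def)
      then show "v \<in> (\<lambda>u. u m) ` blocks (Suc m) V" by (rule rev_image_eqI) simp
    qed (auto simp: blocks_def)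
    have ker: "{u \<in> blocks (Suc m) V. u m = 0} = blocks m V"
      using z by (auto simp: blocks_def less_Suc_eq Suc_le_eq) (metis le_neq_implies_less)
    show ?case
      using pair.rank_nullity_on(2)[OF fs lin, of m] fs IH(2) unfolding im ker by simp
  qed
  then show "fin_subspace (\<lambda>c u p. s c (u p)) (blocks m V)"
    "vdim (\<lambda>c u p. s c (u p)) (blocks m V) = (\<Sum>p<m. vdim s (V p))"
    unfolding S_def by auto
qed

section \<open>Graded free modules and their homomorphisms\<close>

lemma free_module_simps [simp]:
  "carrier (free_module n a :: ('k::field mpoly, _) gr_module)
     = {v. (\<forall>i<length a. v i \<in> carrier (poly_ring n)) \<and> (\<forall>i\<ge>length a. v i = 0)}"
  "\<zero>\<^bsub>(free_module n a :: ('k mpoly, _) gr_module)\<^esub> = 0"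
  "v \<oplus>\<^bsub>(free_module n a :: ('k mpoly, _) gr_module)\<^esub> w = v + w"
  "p \<odot>\<^bsub>(free_module n a :: ('k mpoly, _) gr_module)\<^esub> v = (\<lambda>i. p * v i)"
  by (auto simp: free_module_def fun_eq_iff)

lemma hcomp_free_module:
  "hcomp (free_module n a :: ('k::field mpoly, _) gr_module) d
     = blocks (length a) (\<lambda>i. poly_comp n (d - a ! i))"
  by (simp add: free_module_def blocks_def)

abbreviation vscale :: "'k::field \<Rightarrow> (nat \<Rightarrow> 'k mpoly) \<Rightarrow> nat \<Rightarrow> 'k mpoly" where
  "vscale c v i \<equiv> Poly_Mapping.single 0 c * v i"

abbreviation wscale :: "'k::field \<Rightarrow> (nat \<Rightarrow> nat \<Rightarrow> 'k mpoly) \<Rightarrow> nat \<Rightarrow> nat \<Rightarrow> 'k mpoly" where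
  "wscale c u p q \<equiv> Poly_Mapping.single 0 c * u p q"

lemma vector_space_vscale: "vector_space vscale"
  by (rule vector_space_pointwise[OF vector_space_scale0])

lemma vector_space_wscale: "vector_space wscale"
  by (rule vector_space_pointwise[OF vector_space_vscale])

lemma fin_subspace_hcomp_free:
  "fin_subspace vscale (hcomp (free_module n a :: ('k::field mpoly, _) gr_module) d)"
  unfolding hcomp_free_module
  by (rule fin_subspace_blocks[OF vector_space_scale0]) (rule fin_subspace_poly_comp)

lemma hcomp_free_carrier:
  "v \<in> hcomp (free_module n a :: ('k::field mpoly, _) gr_module) d \<Longrightarrow>
     v \<in> carrier (free_module n a :: ('k::field mpoly, _) gr_module)"
  by (auto simp: hcomp_free_module blocks_def intro: poly_comp_polys)

lemma sum_fun_apply: "(sum g A :: 'i \<Rightarrow> 'b::comm_monoid_add) i = (\<Sum>x\<in>A. g x i)"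
  by (induction A rule: infinite_finite_induct) auto

definition mat_act :: "nat \<Rightarrow> (nat \<Rightarrow> nat \<Rightarrow> 'k::field mpoly) \<Rightarrow> (nat \<Rightarrow> 'k mpoly) \<Rightarrow> nat \<Rightarrow> 'k mpoly" where
  "mat_act m A v q = (\<Sum>p<m. v p * A p q)"

lemma mat_act_simps:
  "mat_act m A (v + w) = mat_act m A v + mat_act m A w"
  "mat_act m A (\<lambda>i. r * v i) = (\<lambda>q. r * mat_act m A v q)"
  "mat_act m A 0 = 0"
  by (auto simp: mat_act_def fun_eq_iff distrib_right sum.distrib sum_distrib_left mult.assoc)

lemma linear_mat_act: "Vector_Spaces.linear vscale vscale (mat_act m A)"
proof -
  interpret vector_space vscale by (rule vector_space_vscale)
  interpret vector_space_pair vscale vscale ..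
  show ?thesis by unfold_locales (simp_all add: mat_act_simps)
qed

text \<open>
  A homomorphism is only constrained on its carrier. Its matrix extends it to a linear map on
  all vectors of polynomials, and it allows one to apply the map to one factor of a tensor
  product of free modules.
\<close>

lemma free_hom_matrix:
  fixes h :: "(nat \<Rightarrow> 'k::field mpoly) \<Rightarrow> nat \<Rightarrow> 'k mpoly"
  assumes h: "h \<in> LinearCombinations.module_hom (poly_ring n)
      (free_module n a) (free_module n b)"
  obtains A where "\<And>v. v \<in> carrier (free_module n a) \<Longrightarrow> h v = mat_act (length a) A v"
    and "\<And>p q. q \<ge> length b \<Longrightarrow> A p q = 0"
proof -
  let ?F = "free_module n a :: ('k mpoly, _) gr_module"
  let ?e = "\<lambda>p i. if i = p then 1 else (0 :: 'k mpoly)"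
  define A where "A p q = (if p < length a then h (?e p) q else 0)" for p q
  have add: "h (v + w) = h v + h w" if "v \<in> carrier ?F" "w \<in> carrier ?F" for v w
    using LinearCombinations.module_hom_add[OF h that] by simp
  have smul: "h (\<lambda>i. r * v i) = (\<lambda>i. r * h v i)" if "r \<in> carrier (poly_ring n)" "v \<in> carrier ?F" for r v
    using LinearCombinations.module_hom_smult[OF h that] by simp
  have e: "?e p \<in> carrier ?F" if "p < length a" for p using that by auto
  have h0: "h 0 = 0" using smul[of 0 0] by (auto simp: fun_eq_iff zero_fun_def)
  have *: "h (\<lambda>i. if i \<in> S then v i else 0) = (\<lambda>q. \<Sum>p\<in>S. v p * A p q)"
    if v: "v \<in> carrier ?F" and S: "finite S" "S \<subseteq> {..<length a}" for v S
    using S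
  proof (induction S)
    case empty
    then show ?case using h0 by (simp add: zero_fun_def)
  next
    case (insert x S)
    have x: "x < length a" using insert by simp
    let ?X = "\<lambda>i. v x * ?e x i" and ?Y = "\<lambda>i. if i \<in> S then v i else 0"
    have split: "(\<lambda>i. if i \<in> insert x S then v i else 0) = ?X + ?Y"
      using insert by (auto simp: fun_eq_iff)
    have XY: "?X \<in> carrier ?F" "?Y \<in> carrier ?F" "v x \<in> carrier (poly_ring n)"
      using v x by auto
    have "h (?X + ?Y) = h ?X + h ?Y" by (rule add[OF XY(1,2)])
    also have "h ?X = (\<lambda>q. v x * A x q)"
      using smul[OF XY(3) e[OF x]] x by (simp add: A_def)
    also have "h ?Y = (\<lambda>q. \<Sum>p\<in>S. v p * A p q)" using insert by simp
    finally show ?case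
      unfolding split by (rule trans) (use insert in \<open>simp add: fun_eq_iff\<close>)
  qed
  show thesis
  proof (rule that[of A])
    fix v assume v: "v \<in> carrier ?F"
    then have "v = (\<lambda>i. if i \<in> {..<length a} then v i else 0)" by (auto simp: fun_eq_iff)
    then show "h v = mat_act (length a) A v"
      using *[OF v, of "{..<length a}"] by (simp add: mat_act_def fun_eq_iff)
  next
    fix p q assume "q \<ge> length b"
    then show "A p q = 0"
      using LinearCombinations.module_hom_closed[OF h] e[of p] by (auto simp: A_def Pi_iff)
  qed
qed

text \<open>
  The homogeneous part of degree \<open>d\<close> of a vector in the free module with generator degrees \<open>a\<close>.
\<close>

definition vpart :: "int list \<Rightarrow> int \<Rightarrow> (nat \<Rightarrow> 'k::field mpoly) \<Rightarrow> nat \<Rightarrow> 'k mpoly" where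
  "vpart a d v i = (if i < length a then hpart (d - a ! i) (v i) else 0)"

lemma vpart_in:
  "v \<in> carrier (free_module n a :: ('k::field mpoly, _) gr_module) \<Longrightarrow>
     vpart a d v \<in> hcomp (free_module n a) d"
  by (auto simp: hcomp_free_module blocks_def vpart_def intro: hpart_in)

lemma vpart_homogeneous:
  "v \<in> hcomp (free_module n a :: ('k::field mpoly, _) gr_module) c \<Longrightarrow>
     vpart a d v = (if c = d then v else 0)"
  by (auto simp: hcomp_free_module blocks_def vpart_def fun_eq_iff hpart_homogeneous not_less)

lemma vpart_sum: "vpart a d (sum g A) = (\<Sum>x\<in>A. vpart a d (g x))"
  by (auto simp: vpart_def fun_eq_iff sum_fun_apply hpart_sum)

lemma vpart_expand:
  assumes "v \<in> carrier (free_module n a :: ('k::field mpoly, _) gr_module)"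
  obtains D where "finite D" "v = (\<Sum>d\<in>D. vpart a d v)" "\<And>d. d \<notin> D \<Longrightarrow> vpart a d v = 0"
proof -
  \<comment> \<open>The degrees of all terms that occur in \<open>v\<close>.\<close>
  define D where "D = (\<Union>i<length a. (\<lambda>m. int (mon_degree m) + a ! i) ` Poly_Mapping.keys (v i))"
  have fin: "finite D" by (simp add: D_def)
  have mem: "int (mon_degree m) + a ! i \<in> D" if "i < length a" "m \<in> Poly_Mapping.keys (v i)" for i m
    using that by (auto simp: D_def)
  have "v i = (\<Sum>d\<in>D. vpart a d v i)" for i
  proof (cases "i < length a")
    case True
    have "(\<Sum>d\<in>D. vpart a d v i) = (\<Sum>d\<in>(\<lambda>d. d - a ! i) ` D. hpart d (v i))"
      using True by (subst sum.reindex) (auto simp: vpart_def inj_on_def)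
    also have "\<dots> = v i"
      using fin mem[OF True] by (intro sum_hpart) force+
    finally show ?thesis by simp
  next
    case False
    then show ?thesis using assms by (simp add: vpart_def)
  qed
  then have e: "v = (\<Sum>d\<in>D. vpart a d v)" by (simp add: fun_eq_iff sum_fun_apply)
  have "vpart a d v = 0" if "d \<notin> D" for d
  proof
    fix i
    show "vpart a d v i = 0 i"
    proof (cases "i < length a")
      case True
      have "Poly_Mapping.keys (hpart (d - a ! i) (v i)) = {}"
        using mem[OF True] that by (force simp: keys_hpart)
      then show ?thesis using True by (simp add: vpart_def)
    qed (simp add: vpart_def)
  qed
  with fin e show thesis by (rule that)
qed

lemma free_carrier_sum:
  "(\<And>x. x \<in> S \<Longrightarrow> g x \<in> carrier (free_module n a :: ('k::field mpoly, _) gr_module)) \<Longrightarrow>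
    sum g S \<in> carrier (free_module n a)"
  by (auto simp: sum_fun_apply intro!: polys_sum sum.neutral)

lemma graded_homD:
  assumes "graded_hom n M N h"
  shows "h \<in> LinearCombinations.module_hom (poly_ring n) M N"
    and "x \<in> hcomp M d \<Longrightarrow> h x \<in> hcomp N d"
  using assms by (auto simp: graded_hom_def)

lemma graded_hom_vpart:
  fixes h :: "(nat \<Rightarrow> 'k::field mpoly) \<Rightarrow> nat \<Rightarrow> 'k mpoly"
  assumes h: "graded_hom n (free_module n a) (free_module n b) h"
    and v: "v \<in> carrier (free_module n a)"
  shows "h (vpart a d v) = vpart b d (h v)"
proof -
  let ?F = "free_module n a :: ('k mpoly, _) gr_module"
  obtain A where A: "\<And>v. v \<in> carrier ?F \<Longrightarrow> h v = mat_act (length a) A v"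
    using free_hom_matrix[OF graded_homD(1)[OF h]] by metis
  interpret A: Vector_Spaces.linear vscale vscale "mat_act (length a) A" by (rule linear_mat_act)
  obtain D where D: "finite D" "v = (\<Sum>d\<in>D. vpart a d v)" "\<And>d. d \<notin> D \<Longrightarrow> vpart a d v = 0"
    using vpart_expand[OF v] by blast
  have vp: "vpart a c v \<in> carrier ?F" for c by (rule hcomp_free_carrier[OF vpart_in[OF v]])
  have "h v = mat_act (length a) A v" by (rule A[OF v])
  also have "\<dots> = (\<Sum>c\<in>D. h (vpart a c v))"
    by (subst D(2)) (simp only: A.sum A[OF vp])
  finally have "vpart b d (h v) = (\<Sum>c\<in>D. vpart b d (h (vpart a c v)))"
    by (simp only: vpart_sum)
  also have "\<dots> = (\<Sum>c\<in>D. if c = d then h (vpart a d v) else 0)"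
    by (intro sum.cong refl) (simp add: vpart_homogeneous[OF graded_homD(2)[OF h vpart_in[OF v]]])
  also have "\<dots> = h (vpart a d v)"
    using D(1) D(3)[of d] A[OF vp, of d] by (simp add: mat_act_simps)
  finally show ?thesis by simp
qed

text \<open>
  A preimage of a homogeneous element may be replaced by its homogeneous part.
\<close>

lemma graded_image:
  fixes h :: "(nat \<Rightarrow> 'k::field mpoly) \<Rightarrow> nat \<Rightarrow> 'k mpoly"
  assumes h: "graded_hom n (free_module n a) (free_module n b) h"
  shows "h ` carrier (free_module n a) \<inter> hcomp (free_module n b) d
    = h ` hcomp (free_module n a) d"
proof (intro equalityI subsetI)
  fix x assume x: "x \<in> h ` carrier (free_module n a) \<inter> hcomp (free_module n b) d"
  then obtain v where v: "v \<in> carrier (free_module n a)" "x = h v" by blast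
  have "x = h (vpart a d v)"
    using x vpart_homogeneous[of x n b d d] by (simp add: graded_hom_vpart[OF h v(1)] v(2))
  then show "x \<in> h ` hcomp (free_module n a) d"
    using vpart_in[OF v(1)] by blast
qed (use hcomp_free_carrier graded_homD(2)[OF h] in blast)

section \<open>Subquotients of free modules\<close>

definition poly_submodule :: "nat \<Rightarrow> (nat \<Rightarrow> 'k::field mpoly) set \<Rightarrow> bool" where
  "poly_submodule n Z \<longleftrightarrow> 0 \<in> Z \<and> (\<forall>x\<in>Z. \<forall>y\<in>Z. x + y \<in> Z) \<and>
     (\<forall>p\<in>carrier (poly_ring n). \<forall>x\<in>Z. (\<lambda>i. p * x i) \<in> Z)"

lemma poly_submoduleD:
  assumes "poly_submodule n Z"
  shows "0 \<in> Z" "x \<in> Z \<Longrightarrow> y \<in> Z \<Longrightarrow> x + y \<in> Z"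
    "p \<in> carrier (poly_ring n) \<Longrightarrow> x \<in> Z \<Longrightarrow> (\<lambda>i. p * x i) \<in> Z"
    "x \<in> Z \<Longrightarrow> - x \<in> Z" "x \<in> Z \<Longrightarrow> y \<in> Z \<Longrightarrow> x - y \<in> Z"
proof -
  show *: "x \<in> Z \<Longrightarrow> y \<in> Z \<Longrightarrow> x + y \<in> Z" "p \<in> carrier (poly_ring n) \<Longrightarrow> x \<in> Z \<Longrightarrow> (\<lambda>i. p * x i) \<in> Z"
    "0 \<in> Z" for x y p using assms by (auto simp: poly_submodule_def)
  show m: "x \<in> Z \<Longrightarrow> - x \<in> Z" for x
    using *(2)[of "- 1" x] by (simp add: fun_Compl_def)
  show "x \<in> Z \<Longrightarrow> y \<in> Z \<Longrightarrow> x - y \<in> Z"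
    using *(1)[of x "- y"] m[of y] by simp
qed

definition coset :: "'v::ab_group_add set \<Rightarrow> 'v \<Rightarrow> 'v set" where
  "coset B x = (\<lambda>b. b + x) ` B"

lemma r_coset_free_module: "B +>\<^bsub>(free_module n a :: ('k::field mpoly, _) gr_module)\<^esub> x = coset B x"
  by (auto simp: a_r_coset_def r_coset_def coset_def)

lemma subquotient_simps:
  fixes a n
  defines "F \<equiv> free_module n a :: ('k::field mpoly, _) gr_module"
  shows "carrier (subquotient F Z B) = coset B ` Z" "\<zero>\<^bsub>subquotient F Z B\<^esub> = B"
    "X \<oplus>\<^bsub>subquotient F Z B\<^esub> Y = (\<Union>x\<in>X. \<Union>y\<in>Y. {x + y})"
    "p \<odot>\<^bsub>subquotient F Z B\<^esub> X = (\<Union>x\<in>X. coset B (\<lambda>i. p * x i))"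
    "hcomp (subquotient F Z B) d = coset B ` (Z \<inter> hcomp F d)"
  unfolding F_def subquotient_def r_coset_free_module
  by (auto simp: set_add_def set_mult_def)

locale free_subquotient =
  fixes n :: nat and a :: "int list" and Z B :: "(nat \<Rightarrow> 'k::field mpoly) set"
  assumes Z: "poly_submodule n Z" and B: "poly_submodule n B" and BZ: "B \<subseteq> Z"
    and ZF: "Z \<subseteq> carrier (free_module n a)"
begin

abbreviation "F \<equiv> free_module n a :: ('k mpoly, _) gr_module"
abbreviation "Q \<equiv> subquotient F Z B"

lemma coset_eq_iff: "coset B x = coset B y \<longleftrightarrow> x - y \<in> B"
proof
  assume "coset B x = coset B y"
  moreover have "x \<in> coset B x" unfolding coset_def using poly_submoduleD(1)[OF B] by force
  ultimately show "x - y \<in> B" by (auto simp: coset_def)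
next
  assume *: "x - y \<in> B"
  have "b + x \<in> coset B y" if "b \<in> B" for b
    unfolding coset_def using poly_submoduleD(2)[OF B that *]
    by (intro image_eqI[of _ _ "b + (x - y)"]) simp_all
  moreover have "b + y \<in> coset B x" if "b \<in> B" for b
    unfolding coset_def using poly_submoduleD(5)[OF B that *]
    by (intro image_eqI[of _ _ "b - (x - y)"]) simp_all
  ultimately show "coset B x = coset B y" unfolding coset_def by blast
qed

lemma coset_0: "coset B 0 = B"
  by (simp add: coset_def)

lemma coset_eq_zero_iff: "coset B x = B \<longleftrightarrow> x \<in> B"
  using coset_eq_iff[of x 0] by (simp add: coset_0)

lemma coset_add: "coset B x \<oplus>\<^bsub>Q\<^esub> coset B y = coset B (x + y)"
proof -
  have "b + x + (c + y) \<in> coset B (x + y)" if "b \<in> B" "c \<in> B" for b c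
    unfolding coset_def using poly_submoduleD(2)[OF B that]
    by (intro image_eqI[of _ _ "b + c"]) (simp_all add: algebra_simps)
  moreover have "\<exists>u\<in>coset B x. \<exists>v\<in>coset B y. b + (x + y) = u + v" if "b \<in> B" for b
    using that poly_submoduleD(1)[OF B]
    by (intro bexI[of _ "b + x"] bexI[of _ "0 + y"]) (auto simp: coset_def algebra_simps)
  ultimately show ?thesis unfolding subquotient_simps by (auto simp: coset_def)
qed

lemma coset_smult:
  assumes p: "p \<in> carrier (poly_ring n)"
  shows "p \<odot>\<^bsub>Q\<^esub> coset B x = coset B (\<lambda>i. p * x i)"
proof -
  have "coset B (\<lambda>i. p * (b + x) i) = coset B (\<lambda>i. p * x i)" if "b \<in> B" for b
  proof -
    have "(\<lambda>i. p * (b + x) i) - (\<lambda>i. p * x i) = (\<lambda>i. p * b i)"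
      by (simp add: fun_eq_iff distrib_left)
    then show ?thesis using poly_submoduleD(3)[OF B p that] by (simp add: coset_eq_iff)
  qed
  then show ?thesis
    unfolding subquotient_simps using poly_submoduleD(1)[OF B] by (auto simp: coset_def)
qed

lemma carrier_subquotient: "carrier Q = coset B ` Z"
  by (simp add: subquotient_simps)

lemma zero_subquotient: "\<zero>\<^bsub>Q\<^esub> = coset B 0"
  by (simp add: subquotient_simps coset_0)

lemma module_subquotient: "Module.module (poly_ring n) Q"
proof (rule module_criteria)
  note ZD = poly_submoduleD[OF Z]
  note c = carrier_subquotient zero_subquotient
  show "cring (poly_ring n :: 'k mpoly ring)" by (rule cring_poly_ring)
  show "\<forall>v\<in>carrier Q. \<exists>w\<in>carrier Q. v \<oplus>\<^bsub>Q\<^esub> w = \<zero>\<^bsub>Q\<^esub>"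
  proof
    fix v assume "v \<in> carrier Q"
    then obtain x where "x \<in> Z" "v = coset B x" by (auto simp: c)
    then show "\<exists>w\<in>carrier Q. v \<oplus>\<^bsub>Q\<^esub> w = \<zero>\<^bsub>Q\<^esub>"
      unfolding c using ZD(4)[of x] by (intro bexI[of _ "coset B (- x)"]) (simp_all add: coset_add)
  qed
qed (use poly_submoduleD[OF Z] carrier_subquotient zero_subquotient in
    \<open>auto simp: coset_add coset_smult algebra_simps plus_fun_def\<close>)

lemma hcomp_subquotient_subspace:
  shows "hcomp Q d \<subseteq> carrier Q" "\<zero>\<^bsub>Q\<^esub> \<in> hcomp Q d"
    "x \<in> hcomp Q d \<Longrightarrow> y \<in> hcomp Q d \<Longrightarrow> x \<oplus>\<^bsub>Q\<^esub> y \<in> hcomp Q d"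
    "p \<in> poly_comp n c \<Longrightarrow> x \<in> hcomp Q d \<Longrightarrow> p \<odot>\<^bsub>Q\<^esub> x \<in> hcomp Q (c + d)"
proof -
  note ZD = poly_submoduleD[OF Z]
  have zero: "0 \<in> hcomp F d" by (simp add: hcomp_free_module blocks_def)
  show "hcomp Q d \<subseteq> carrier Q" by (auto simp: subquotient_simps)
  show "\<zero>\<^bsub>Q\<^esub> \<in> hcomp Q d"
    unfolding zero_subquotient subquotient_simps(5) using ZD(1) by (intro imageI IntI zero)
  show "x \<oplus>\<^bsub>Q\<^esub> y \<in> hcomp Q d" if "x \<in> hcomp Q d" "y \<in> hcomp Q d"
  proof -
    obtain v w where "x = coset B v" "y = coset B w" "v \<in> Z \<inter> hcomp F d" "w \<in> Z \<inter> hcomp F d"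
      using \<open>x \<in> hcomp Q d\<close> \<open>y \<in> hcomp Q d\<close> unfolding subquotient_simps(5) by blast
    moreover from this have "v + w \<in> Z \<inter> hcomp F d"
      using ZD(2) by (auto simp: hcomp_free_module blocks_def)
    ultimately show ?thesis
      unfolding subquotient_simps(5) by (simp add: coset_add)
  qed
  show "p \<odot>\<^bsub>Q\<^esub> x \<in> hcomp Q (c + d)" if "p \<in> poly_comp n c" "x \<in> hcomp Q d"
  proof -
    obtain v where v: "x = coset B v" "v \<in> Z \<inter> hcomp F d"
      using \<open>x \<in> hcomp Q d\<close> unfolding subquotient_simps(5) by blast
    moreover have "(\<lambda>i. p * v i) \<in> Z"
      using v \<open>p \<in> poly_comp n c\<close> by (auto intro: ZD(3) poly_comp_polys)
    moreover have "(\<lambda>i. p * v i) \<in> hcomp F (c + d)"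
      using v poly_comp_mult[OF \<open>p \<in> poly_comp n c\<close>]
      by (auto simp: hcomp_free_module blocks_def add_diff_eq[symmetric])
    ultimately show ?thesis
      unfolding subquotient_simps(5) using poly_comp_polys[OF \<open>p \<in> poly_comp n c\<close>]
      by (simp add: coset_smult)
  qed
qed

end

text \<open>
  The scalars act through the constant polynomials.
\<close>

lemma vectorspace_comp_space:
  fixes N :: "('k::field mpoly, 'm) gr_module"
  assumes N: "Module.module (poly_ring n) N"
    and sub: "hcomp N d \<subseteq> carrier N" "\<zero>\<^bsub>N\<^esub> \<in> hcomp N d"
      "\<And>x y. x \<in> hcomp N d \<Longrightarrow> y \<in> hcomp N d \<Longrightarrow> x \<oplus>\<^bsub>N\<^esub> y \<in> hcomp N d"
      "\<And>c x. x \<in> hcomp N d \<Longrightarrow> Poly_Mapping.single 0 c \<odot>\<^bsub>N\<^esub> x \<in> hcomp N d"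
  shows "vectorspace class_ring (comp_space N d)"
proof -
  interpret N: Module.module "poly_ring n" N by (rule N)
  have in_c: "x \<in> carrier N" if "x \<in> hcomp N d" for x using that sub(1) by blast
  have s: "Poly_Mapping.single 0 c \<in> carrier (poly_ring n)" for c :: 'k by simp
  show ?thesis
  proof (rule vs_criteria)
    show "field (class_ring :: 'k ring)" by (rule class_field)
    show "\<forall>v\<in>carrier (comp_space N d). \<exists>w\<in>carrier (comp_space N d).
        v \<oplus>\<^bsub>comp_space N d\<^esub> w = \<zero>\<^bsub>comp_space N d\<^esub>"
    proof
      fix v assume "v \<in> carrier (comp_space N d)"
      then have v: "v \<in> hcomp N d" by (simp add: comp_space_def)
      have "v \<oplus>\<^bsub>N\<^esub> (Poly_Mapping.single 0 (- 1) \<odot>\<^bsub>N\<^esub> v) = (1 + Poly_Mapping.single 0 (- 1)) \<odot>\<^bsub>N\<^esub> v"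
        using N.smult_l_distr[of 1 "Poly_Mapping.single 0 (- 1)" v] N.smult_one[OF in_c[OF v]] in_c[OF v] by simp
      also have "(1 :: 'k mpoly) + Poly_Mapping.single 0 (- 1) = 0"
        unfolding single_one[symmetric] single_add[symmetric] by simp
      finally have "v \<oplus>\<^bsub>N\<^esub> (Poly_Mapping.single 0 (- 1) \<odot>\<^bsub>N\<^esub> v) = \<zero>\<^bsub>N\<^esub>"
        using N.smult_l_null[OF in_c[OF v]] by simp
      then show "\<exists>w\<in>carrier (comp_space N d). v \<oplus>\<^bsub>comp_space N d\<^esub> w = \<zero>\<^bsub>comp_space N d\<^esub>"
        using sub(4)[OF v, of "- 1"] by (auto simp: comp_space_def)
    qed
    show "\<forall>c e v. c \<in> carrier class_ring \<and> e \<in> carrier class_ring \<and> v \<in> carrier (comp_space N d) \<longrightarrow>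
        (c \<otimes>\<^bsub>class_ring\<^esub> e) \<odot>\<^bsub>comp_space N d\<^esub> v = c \<odot>\<^bsub>comp_space N d\<^esub> (e \<odot>\<^bsub>comp_space N d\<^esub> v)"
      using N.smult_assoc1[OF s s in_c] by (simp add: comp_space_def mult_single)
    show "\<forall>v\<in>carrier (comp_space N d). \<one>\<^bsub>class_ring\<^esub> \<odot>\<^bsub>comp_space N d\<^esub> v = v"
      using N.smult_one[OF in_c] by (simp add: comp_space_def single_one)
    show "\<forall>c e v. c \<in> carrier class_ring \<and> e \<in> carrier class_ring \<and> v \<in> carrier (comp_space N d) \<longrightarrow>
        (c \<oplus>\<^bsub>class_ring\<^esub> e) \<odot>\<^bsub>comp_space N d\<^esub> v
          = c \<odot>\<^bsub>comp_space N d\<^esub> v \<oplus>\<^bsub>comp_space N d\<^esub> e \<odot>\<^bsub>comp_space N d\<^esub> v"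
      using N.smult_l_distr[OF s s in_c] by (simp add: comp_space_def single_add)
    show "\<forall>c v w. c \<in> carrier class_ring \<and> v \<in> carrier (comp_space N d) \<and> w \<in> carrier (comp_space N d) \<longrightarrow>
        c \<odot>\<^bsub>comp_space N d\<^esub> (v \<oplus>\<^bsub>comp_space N d\<^esub> w)
          = c \<odot>\<^bsub>comp_space N d\<^esub> v \<oplus>\<^bsub>comp_space N d\<^esub> c \<odot>\<^bsub>comp_space N d\<^esub> w"
      using N.smult_r_distr[OF s in_c in_c] by (simp add: comp_space_def)
  qed (use sub in_c in \<open>auto simp: comp_space_def N.a_ac\<close>)
qed

context free_subquotient
begin

text \<open>
  The cosets of \<open>Z\<^sub>d\<close> modulo \<open>B\<close> are the image of a linear map on \<open>Z\<^sub>d\<close> with kernel \<open>B\<^sub>d\<close>.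
\<close>

lemma comp_dim_subquotient:
  "vdim vscale (Z \<inter> hcomp F d) = comp_dim Q d + vdim vscale (B \<inter> hcomp F d)"
proof -
  interpret vector_space "vscale :: 'k \<Rightarrow> _" by (rule vector_space_vscale)
  note H = hcomp_subquotient_subspace
  have V: "vectorspace class_ring (comp_space Q d)"
    using vectorspace_comp_space[OF module_subquotient H(1,2,3)] H(4)[of _ 0 _ d] by simp
  have "local.subspace (Z \<inter> hcomp F d)"
    using poly_submoduleD[OF Z] by (auto simp: subspace_def hcomp_free_module blocks_def)
  then have fin: "fin_subspace vscale (Z \<inter> hcomp F d)"
    by (intro fin_subspace_mono[OF fin_subspace_hcomp_free[of n a d]]) auto
  have hom: "coset B \<in> LinearCombinations.module_hom class_ring (space_of vscale (Z \<inter> hcomp F d)) (comp_space Q d)"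
    using coset_add coset_smult
    by (auto simp: LinearCombinations.module_hom_def comp_space_def subquotient_simps(1,2,5))
  have "comp_space Q d\<lparr>carrier := coset B ` (Z \<inter> hcomp F d)\<rparr> = comp_space Q d"
    by (simp add: comp_space_def subquotient_simps(5))
  moreover have "{x \<in> Z \<inter> hcomp F d. coset B x = \<zero>\<^bsub>comp_space Q d\<^esub>} = B \<inter> hcomp F d"
    using BZ by (auto simp: comp_space_def subquotient_simps(2) coset_eq_zero_iff)
  ultimately show ?thesis
    using rank_nullity_abstract[OF fin V hom] by (simp add: comp_dim_def)
qed

end

section \<open>Lower bounds for the regularity\<close>

lemma cm_reg_ge: "tor_nonzero n M i k \<Longrightarrow> ereal (real_of_int (k - int i)) \<le> cm_reg n M"
  unfolding cm_reg_def by (rule Sup_upper) blast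

lemma finsum_zero_module:
  assumes "Module.module R N" "\<And>x. x \<in> A \<Longrightarrow> g x = \<zero>\<^bsub>N\<^esub>"
  shows "finsum N g A = \<zero>\<^bsub>N\<^esub>"
proof -
  interpret Module.module R N by fact
  show ?thesis by (rule M.add.finprod_one_eqI) (use assms(2) in auto)
qed

lemma poly_submodule_free_module: "poly_submodule n (carrier (free_module n a :: ('k::field mpoly, _) gr_module))"
  by (auto simp: poly_submodule_def)

lemma module_free_module: "Module.module (poly_ring n) (free_module n a :: ('k::field mpoly, _) gr_module)"
proof (rule module_criteria)
  let ?F = "free_module n a :: ('k mpoly, _) gr_module"
  show "cring (poly_ring n :: 'k mpoly ring)" by (rule cring_poly_ring)
  show "\<forall>v\<in>carrier ?F. \<exists>w\<in>carrier ?F. v \<oplus>\<^bsub>?F\<^esub> w = \<zero>\<^bsub>?F\<^esub>"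
  proof
    fix v assume "v \<in> carrier ?F"
    then show "\<exists>w\<in>carrier ?F. v \<oplus>\<^bsub>?F\<^esub> w = \<zero>\<^bsub>?F\<^esub>"
      by (intro bexI[of _ "- v"]) auto
  qed
qed (auto simp: algebra_simps fun_eq_iff)

lemma finsum_free_module:
  fixes a n
  defines "F \<equiv> free_module n a :: ('k::field mpoly, _) gr_module"
  assumes g: "\<And>x. x \<in> A \<Longrightarrow> g x \<in> carrier F"
  shows "finsum F g A = sum g A"
proof -
  interpret F: Module.module "poly_ring n" F unfolding F_def by (rule module_free_module)
  have zero: "\<zero>\<^bsub>F\<^esub> = 0" by (simp add: F_def)
  show ?thesis using g
  proof (induction A rule: infinite_finite_induct)
    case (insert x A)
    then have "finsum F g (insert x A) = g x \<oplus>\<^bsub>F\<^esub> finsum F g A"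
      by (intro F.finsum_insert) auto
    then show ?case using insert by (simp add: F_def)
  qed (simp_all add: zero)
qed

text \<open>
  The generator \<open>u\<close> is a cycle in homological degree \<open>0\<close> of the Koszul complex. It is no boundary, since a
  boundary of the same degree \<open>a\<close> has entries \<open>\<Sum> x\<^sub>v w\<^sub>v\<close> with \<open>w\<^sub>v\<close> of degree \<open>a - 1\<close>, and the
  entry of such a \<open>w\<^sub>v\<close> at a generator of degree \<open>a\<close> is homogeneous of degree \<open>-1\<close>, hence \<open>0\<close>.
\<close>

lemma cm_reg_free_module_ge:
  assumes a: "a \<in> set as"
  shows "ereal (real_of_int a) \<le> cm_reg n (free_module n as :: ('k::field mpoly, _) gr_module)"
proof -
  let ?F = "free_module n as :: ('k mpoly, _) gr_module"
  obtain q where q: "q < length as" "as ! q = a" using a by (auto simp: in_set_conv_nth)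
  define u :: "nat set \<Rightarrow> nat \<Rightarrow> 'k mpoly" where "u T i = (if T = {} \<and> i = q then 1 else 0)" for T i
  have e: "u {} \<in> hcomp ?F a"
    using q poly_comp_closed(4)[of "1 :: 'k" n] by (auto simp: u_def hcomp_free_module blocks_def single_one)
  have "u T = \<zero>\<^bsub>?F\<^esub>" if "T \<noteq> {}" for T using that by (auto simp: u_def fun_eq_iff)
  then have chain: "u \<in> koszul_chains n ?F 0 a"
    using e by (auto simp: koszul_chains_def card_eq_0_iff dest: finite_subset)
  have cyc: "koszul_diff n ?F u = (\<lambda>T. \<zero>\<^bsub>?F\<^esub>)"
  proof
    fix T
    have "r \<odot>\<^bsub>?F\<^esub> u (insert v T) = \<zero>\<^bsub>?F\<^esub>" for r v by (simp add: u_def fun_eq_iff)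
    then show "koszul_diff n ?F u T = \<zero>\<^bsub>?F\<^esub>"
      unfolding koszul_diff_def by (simp only: finsum_zero_module[OF module_free_module] if_cancel)
  qed
  have "u \<noteq> koszul_diff n ?F w" if w: "w \<in> koszul_chains n ?F (Suc 0) a" for w
  proof
    assume eq: "u = koszul_diff n ?F w"
    have wv: "w {v} \<in> hcomp ?F (a - 1)" if "v < n" for v
      using w that unfolding koszul_chains_def by (auto dest!: spec[of _ "{v}"])
    have wq: "w {v} q = 0" if "v < n" for v
    proof -
      have "w {v} q \<in> poly_comp n (- 1)"
        using wv[OF that] q by (auto simp: hcomp_free_module blocks_def)
      then have "Poly_Mapping.keys (w {v} q) = {}" by (auto simp: poly_comp_iff)
      then show ?thesis by simp
    qed
    have x: "Poly_Mapping.single (Poly_Mapping.single v 1) c \<in> carrier (poly_ring n)" if "v < n" for v and c :: 'k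
      using that by (auto simp: polys_iff)
    have "koszul_diff n ?F w {} =
        (\<Sum>v<n. (\<lambda>i. Poly_Mapping.single (Poly_Mapping.single v 1) ((- 1) ^ card {w \<in> {}. w < v}) * w {v} i))"
      unfolding koszul_diff_def using hcomp_free_carrier[OF wv] x
      by (subst finsum_free_module) (auto simp: Pi_iff)
    then have "koszul_diff n ?F w {} q = 0" using wq by (simp add: sum_fun_apply)
    then show False using eq by (simp add: u_def fun_eq_iff) (metis u_def zero_neq_one)
  qed
  then have "tor_nonzero n ?F 0 a"
    unfolding tor_nonzero_def using chain cyc by blast
  from cm_reg_ge[OF this] show ?thesis by simp
qed

text \<open>
  An element killed by all variables gives a Koszul cycle on the full set of variables. There are
  no chains with more than \<open>n\<close> variables, so a nonzero cycle of this kind is not a boundary.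
\<close>

lemma cm_reg_ge_socle:
  fixes N :: "('k::field mpoly, 'm) gr_module"
  assumes N: "Module.module (poly_ring n) N"
    and H: "\<And>d. hcomp N d \<subseteq> carrier N" 
    and smult: "\<And>p x c d. p \<in> poly_comp n c \<Longrightarrow> x \<in> hcomp N d \<Longrightarrow> p \<odot>\<^bsub>N\<^esub> x \<in> hcomp N (c + d)"
    and x: "x \<in> hcomp N d" "x \<noteq> \<zero>\<^bsub>N\<^esub>" and top: "hcomp N (d + 1) \<subseteq> {\<zero>\<^bsub>N\<^esub>}"
  shows "ereal (real_of_int d) \<le> cm_reg n N"
proof -
  interpret N: Module.module "poly_ring n" N by (rule N)
  define u where "u T = (if T = {..<n} then x else \<zero>\<^bsub>N\<^esub>)" for T
  have full: "T = {..<n}" if "T \<subseteq> {..<n}" "card T = n" for T :: "nat set"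
    using card_subset_eq[of "{..<n}" T] that by simp
  have chain: "u \<in> koszul_chains n N n (d + int n)"
    using x(1) full by (auto simp: koszul_chains_def u_def)
  have xv: "Poly_Mapping.single (Poly_Mapping.single v 1) c \<odot>\<^bsub>N\<^esub> x = \<zero>\<^bsub>N\<^esub>" if "v < n" for v and c :: 'k
  proof -
    have "Poly_Mapping.single (Poly_Mapping.single v 1) c \<in> poly_comp n 1"
      using that by (auto simp: poly_comp_iff polys_iff mon_degree_def)
    from smult[OF this x(1)] top show ?thesis by (auto simp: add.commute)
  qed
  have x': "Poly_Mapping.single (Poly_Mapping.single v 1) c \<in> carrier (poly_ring n)" if "v < n" for v and c :: 'k
    using that by (auto simp: polys_iff)
  have cyc: "koszul_diff n N u = (\<lambda>T. \<zero>\<^bsub>N\<^esub>)"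
  proof
    fix T
    show "koszul_diff n N u T = \<zero>\<^bsub>N\<^esub>"
      unfolding koszul_diff_def using xv x'
      by (auto intro!: finsum_zero_module[OF N] simp: u_def)
  qed
  have "u \<noteq> koszul_diff n N w" if w: "w \<in> koszul_chains n N (Suc n) (d + int n)" for w
  proof
    assume eq: "u = koszul_diff n N w"
    have "koszul_diff n N w {..<n} = \<zero>\<^bsub>N\<^esub>" by (simp add: koszul_diff_def)
    then show False using eq x(2) by (metis u_def)
  qed
  then have "tor_nonzero n N n (d + int n)"
    unfolding tor_nonzero_def using chain cyc by blast
  from cm_reg_ge[OF this] show ?thesis by simp
qed

text \<open>
  Infinitely many jumps of a decreasing filtration would give strict chains of submodules
  of every length.
\<close>

lemma finite_length_bounded:
  assumes fl: "finite_length n N" and T: "\<And>c. submodule (poly_ring n) (T c) N"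
    and mono: "\<And>c c'. c \<le> c' \<Longrightarrow> T c' \<subseteq> T c"
    and jump: "\<And>c. P c \<Longrightarrow> T (c + 1) \<noteq> T (c :: int)"
  shows "\<exists>c0. \<forall>c>c0. \<not> P c"
proof (rule ccontr)
  assume "\<nexists>c0. \<forall>c>c0. \<not> P c"
  then have "\<exists>c>c0. P c" for c0 by blast
  then have "\<exists>r. \<forall>i. P (r i) \<and> r i < r (Suc i)"
    by (intro dependent_nat_choice) blast+
  then obtain r where r: "\<And>i. P (r i)" "\<And>i. r i < r (Suc i)" by blast
  obtain L where L: "\<And>l W. (\<forall>i\<le>l. submodule (poly_ring n) (W i) N) \<and> (\<forall>i<l. W i \<subset> W (Suc i)) \<Longrightarrow> l \<le> L"
    using fl unfolding finite_length_def by blast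
  \<comment> \<open>The filtration decreases along \<open>r\<close>, so its members are listed in reverse order.\<close>
  let ?W = "\<lambda>i. T (r (Suc L - i))"
  have step: "T (r (Suc i)) \<subset> T (r i)" for i
    using mono[of "r i + 1" "r (Suc i)"] mono[of "r i" "r i + 1"] jump[OF r(1)[of i]] r(2)[of i] by auto
  have "?W i \<subset> ?W (Suc i)" if "i < Suc L" for i
    using step[of "Suc L - Suc i"] that by (simp add: Suc_diff_le less_Suc_eq_le)
  then show False using L[of "Suc L" ?W] T by auto
qed

text \<open>
  Intersected with the free module with generator degrees \<open>a\<close>, this is its truncation to degrees
  at least \<open>c\<close>.
\<close>

definition tail :: "int list \<Rightarrow> int \<Rightarrow> (nat \<Rightarrow> 'k::field mpoly) set" where
  "tail a c = {v. \<forall>i<length a. \<forall>m\<in>Poly_Mapping.keys (v i). c \<le> int (mon_degree m) + a ! i}"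

lemma tail_mono: "c \<le> c' \<Longrightarrow> tail a c' \<subseteq> tail a c"
  by (force simp: tail_def)

lemma poly_submodule_tail:
  "poly_submodule n (tail a c :: (nat \<Rightarrow> 'k::field mpoly) set)"
  unfolding poly_submodule_def
proof (intro conjI ballI)
  fix x y :: "nat \<Rightarrow> 'k mpoly" and p :: "'k mpoly"
  show "(0 :: nat \<Rightarrow> 'k mpoly) \<in> tail a c" by (simp add: tail_def)
  show "x + y \<in> tail a c" if "x \<in> tail a c" "y \<in> tail a c"
    using that Poly_Mapping.keys_add[of "x _" "y _"] unfolding tail_def by fastforce
  show "(\<lambda>i. p * x i) \<in> tail a c" if "x \<in> tail a c"
    unfolding tail_def
  proof (intro CollectI allI impI ballI)
    fix i m assume i: "i < length a" and "m \<in> Poly_Mapping.keys (p * x i)"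
    then obtain m1 m2 where "m = m1 + m2" "m2 \<in> Poly_Mapping.keys (x i)"
      using keys_mult[of p "x i"] by blast
    then show "c \<le> int (mon_degree m) + a ! i"
      using that i by (force simp: tail_def mon_degree_add)
  qed
qed

lemma hcomp_subset_tail:
  "hcomp (free_module n a :: ('k::field mpoly, _) gr_module) d \<subseteq> tail a d"
  by (auto simp: hcomp_free_module blocks_def tail_def poly_comp_iff)

lemma vpart_tail:
  assumes "v \<in> tail a c" "d < c"
  shows "vpart a d v = 0"
proof
  fix i
  have "Poly_Mapping.keys (hpart (d - a ! i) (v i)) = {}" if "i < length a"
    using assms that by (force simp: keys_hpart tail_def)
  then show "vpart a d v i = 0 i" by (simp add: vpart_def)
qed

text \<open>
  The module \<open>N\<close> is presented as the image of a graded submodule \<open>Z\<close> of a free module under a map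
  whose compatibility with the gradings is expressed by the assumption \<open>part\<close>. This form
  covers both the augmentation of a resolution and the projection of cocycles onto cohomology,
  and it makes the truncations of \<open>N\<close> images of explicit submodules. If \<open>N\<close> has finite length,
  these truncations show that there is a largest degree of a nonzero element, to which
  the argument with the annihilated element applies.
\<close>

lemma cm_reg_ge_degree:
  fixes N :: "('k::field mpoly, 'm) gr_module" and \<pi> :: "(nat \<Rightarrow> 'k mpoly) \<Rightarrow> 'm" and a n
  defines "F \<equiv> free_module n a :: ('k mpoly, _) gr_module"
  assumes N: "Module.module (poly_ring n) N"
    and H: "\<And>d. hcomp N d \<subseteq> carrier N"
    and smult: "\<And>p x c d. p \<in> poly_comp n c \<Longrightarrow> x \<in> hcomp N d \<Longrightarrow> p \<odot>\<^bsub>N\<^esub> x \<in> hcomp N (c + d)"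
    and fl: "finite_length n N"
    and Z: "poly_submodule n Z" "Z \<subseteq> carrier F" "\<And>v d. v \<in> Z \<Longrightarrow> vpart a d v \<in> Z"
    and im: "\<pi> ` Z = carrier N"
    and add: "\<And>v w. v \<in> Z \<Longrightarrow> w \<in> Z \<Longrightarrow> \<pi> (v + w) = \<pi> v \<oplus>\<^bsub>N\<^esub> \<pi> w"
    and smul: "\<And>p v. p \<in> carrier (poly_ring n) \<Longrightarrow> v \<in> Z \<Longrightarrow> \<pi> (\<lambda>i. p * v i) = p \<odot>\<^bsub>N\<^esub> \<pi> v"
    and part: "\<And>v d. v \<in> Z \<Longrightarrow> \<pi> v \<in> hcomp N d \<Longrightarrow> \<pi> (vpart a d v) = \<pi> v"
    and x: "x \<in> hcomp N d" "x \<noteq> \<zero>\<^bsub>N\<^esub>"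
  shows "ereal (real_of_int d) \<le> cm_reg n N"
proof -
  interpret N: Module.module "poly_ring n" N by (rule N)
  note ZD = poly_submoduleD[OF Z(1)] and TD = poly_submoduleD[OF poly_submodule_tail[of n a]]
  have in_N: "\<pi> v \<in> carrier N" if "v \<in> Z" for v using im that by blast
  have \<pi>0: "\<pi> 0 = \<zero>\<^bsub>N\<^esub>"
    using smul[OF polys_closed(1) ZD(1)] N.smult_l_null[OF in_N[OF ZD(1)]] by (simp add: zero_fun_def)
  define T where "T c = \<pi> ` (Z \<inter> tail a c)" for c
  define P where "P c \<longleftrightarrow> (\<exists>x\<in>hcomp N c. x \<noteq> \<zero>\<^bsub>N\<^esub>)" for c
  have "submodule (poly_ring n) (T c) N" for c
  proof (rule submodule.intro)
    show "T c \<subseteq> carrier N" unfolding T_def using in_N by auto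
    show "\<zero>\<^bsub>N\<^esub> \<in> T c" unfolding T_def using \<pi>0 ZD(1) TD(1)[of c] by force
    show "v \<oplus>\<^bsub>N\<^esub> w \<in> T c" if vw: "v \<in> T c" "w \<in> T c" for v w
    proof -
      obtain v' w' where *: "v = \<pi> v'" "w = \<pi> w'" "v' \<in> Z \<inter> tail a c" "w' \<in> Z \<inter> tail a c"
        using vw unfolding T_def by blast
      then have "v \<oplus>\<^bsub>N\<^esub> w = \<pi> (v' + w')" using add by auto
      moreover have "v' + w' \<in> Z \<inter> tail a c" using * ZD(2) TD(2) by blast
      ultimately show ?thesis unfolding T_def by blast
    qed
    show "r \<odot>\<^bsub>N\<^esub> v \<in> T c" if r: "r \<in> carrier (poly_ring n)" and v: "v \<in> T c" for r v
    proof -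
      obtain v' where *: "v = \<pi> v'" "v' \<in> Z \<inter> tail a c" using v unfolding T_def by blast
      then have "r \<odot>\<^bsub>N\<^esub> v = \<pi> (\<lambda>i. r * v' i)" using smul r by auto
      moreover have "(\<lambda>i. r * v' i) \<in> Z \<inter> tail a c" using * ZD(3) TD(3) r by blast
      ultimately show ?thesis unfolding T_def by blast
    qed
  qed (rule N)
  moreover have "T c' \<subseteq> T c" if "c \<le> c'" for c c'
    unfolding T_def using tail_mono[OF that] by blast
  moreover have "T (c + 1) \<noteq> T c" if "P c" for c
  proof
    assume eq: "T (c + 1) = T c"
    obtain y where y: "y \<in> hcomp N c" "y \<noteq> \<zero>\<^bsub>N\<^esub>" using \<open>P c\<close> unfolding P_def by blast
    then obtain v where v: "v \<in> Z" "y = \<pi> v" using H im by blast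
    have "vpart a c v \<in> tail a c"
      using vpart_in[of v n a c] v(1) Z(2) hcomp_subset_tail unfolding F_def by blast
    then have "y \<in> T c"
      unfolding T_def using part[OF v(1)] y(1) v Z(3)[OF v(1)] by (metis IntI image_eqI)
    then obtain w where w: "w \<in> Z" "w \<in> tail a (c + 1)" "y = \<pi> w" using eq unfolding T_def by blast
    then have "y = \<pi> (vpart a c w)" using part[OF w(1)] y(1) by simp
    then show False using vpart_tail[OF w(2), of c] \<pi>0 y(2) by simp
  qed
  ultimately obtain c0 where c0: "\<And>c. c > c0 \<Longrightarrow> \<not> P c"
    using finite_length_bounded[OF fl, of T P] by metis
  have Pd: "P d" unfolding P_def using x by blast
  have fin: "finite {c. d \<le> c \<and> P c}"
    by (rule finite_subset[of _ "{d..c0}"]) (use c0 in \<open>force simp: not_less[symmetric]\<close>)+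
  define m where "m = Max {c. d \<le> c \<and> P c}"
  have m: "d \<le> m" "P m" using Max_in[OF fin] Pd unfolding m_def by auto
  have "\<not> P (m + 1)"
  proof
    assume "P (m + 1)"
    then have "m + 1 \<le> m" using m(1) Max_ge[OF fin, of "m + 1"] unfolding m_def by simp
    then show False by simp
  qed
  then have "hcomp N (m + 1) \<subseteq> {\<zero>\<^bsub>N\<^esub>}" unfolding P_def by blast
  then have "ereal (real_of_int m) \<le> cm_reg n N"
    using m(2) cm_reg_ge_socle[OF N H smult] unfolding P_def by blast
  then show ?thesis using m(1) by (meson ereal_less_eq(3) of_int_le_iff order_trans)
qed

section \<open>The tensor product of a complex with a resolution\<close>

text \<open>
  The homogeneous maps \<open>\<phi>\<close> and \<open>\<delta>\<close> come with matrices \<open>A\<close> and \<open>D\<close>. An element of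
  \<open>F\<^sub>i \<otimes> E\<^sup>j\<close> is written as a matrix \<open>u\<close> of polynomials, the entry \<open>u p q\<close> belonging to the
  \<open>p\<close>-th generator of \<open>F\<^sub>i\<close> and the \<open>q\<close>-th generator of \<open>E\<^sup>j\<close>. Fixing \<open>p\<close> gives an element of \<open>E\<^sup>j\<close>,
  fixing \<open>q\<close> an element of \<open>F\<^sub>i\<close>.
\<close>

locale tensor_complex =
  fixes n :: nat and e f :: "nat \<Rightarrow> int list"
    and \<phi> \<delta> :: "nat \<Rightarrow> (nat \<Rightarrow> 'k::field mpoly) \<Rightarrow> (nat \<Rightarrow> 'k mpoly)"
    and A D :: "nat \<Rightarrow> nat \<Rightarrow> nat \<Rightarrow> 'k mpoly"
  assumes \<phi>: "graded_hom n (free_module n (e j)) (free_module n (e (Suc j))) (\<phi> j)"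
    and \<delta>: "graded_hom n (free_module n (f (Suc i))) (free_module n (f i)) (\<delta> i)"
    and \<phi>\<phi>: "v \<in> carrier (free_module n (e j)) \<Longrightarrow> \<phi> (Suc j) (\<phi> j v) = 0"
    and exact_\<delta>: "v \<in> carrier (free_module n (f (Suc i))) \<Longrightarrow>
      \<delta> i v = 0 \<longleftrightarrow> v \<in> \<delta> (Suc i) ` carrier (free_module n (f (Suc (Suc i))) :: ('k mpoly, _) gr_module)"
    and e_bound: "j > n \<Longrightarrow> e j = []" and f_bound: "i > n \<Longrightarrow> f i = []"
    and A: "v \<in> carrier (free_module n (e j)) \<Longrightarrow> \<phi> j v = mat_act (length (e j)) (A j) v"
    and A_out: "q \<ge> length (e (Suc j)) \<Longrightarrow> A j p q = 0"
    and D: "v \<in> carrier (free_module n (f (Suc i))) \<Longrightarrow> \<delta> i v = mat_act (length (f (Suc i))) (D i) v"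
    and D_out: "q \<ge> length (f i) \<Longrightarrow> D i p q = 0"
begin

abbreviation "EE j \<equiv> free_module n (e j) :: ('k mpoly, _) gr_module"
abbreviation "FF i \<equiv> free_module n (f i) :: ('k mpoly, _) gr_module"

text \<open>
  The degree \<open>0\<close> part of \<open>F\<^sub>i \<otimes> E\<^sup>j\<close>: the \<open>p\<close>-th generator of \<open>F\<^sub>i\<close> has degree \<open>f i ! p\<close>, so
  its coefficient is an element of \<open>E\<^sup>j\<close> of the opposite degree.
\<close>

definition cell :: "nat \<Rightarrow> nat \<Rightarrow> (nat \<Rightarrow> nat \<Rightarrow> 'k mpoly) set" where
  "cell i j = blocks (length (f i)) (\<lambda>p. hcomp (EE j) (- f i ! p))"

text \<open>
  These are \<open>1 \<otimes> \<phi>\<close> and \<open>\<delta> \<otimes> 1\<close>.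
\<close>

definition horiz :: "nat \<Rightarrow> (nat \<Rightarrow> nat \<Rightarrow> 'k mpoly) \<Rightarrow> nat \<Rightarrow> nat \<Rightarrow> 'k mpoly" where
  "horiz j u p = mat_act (length (e j)) (A j) (u p)"

definition vert :: "nat \<Rightarrow> (nat \<Rightarrow> nat \<Rightarrow> 'k mpoly) \<Rightarrow> nat \<Rightarrow> nat \<Rightarrow> 'k mpoly" where
  "vert i u p q = mat_act (length (f (Suc i))) (D i) (\<lambda>p'. u p' q) p"

lemma cell_row: "u \<in> cell i j \<Longrightarrow> p < length (f i) \<Longrightarrow> u p \<in> hcomp (EE j) (- f i ! p)"
  by (simp add: cell_def blocks_def)

lemma cell_row_out: "u \<in> cell i j \<Longrightarrow> p \<ge> length (f i) \<Longrightarrow> u p = 0"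
  by (simp add: cell_def blocks_def)

lemma cell_iff_columns:
  "u \<in> cell i j \<longleftrightarrow> (\<forall>q<length (e j). (\<lambda>p. u p q) \<in> hcomp (FF i) (- e j ! q)) \<and>
     (\<forall>q\<ge>length (e j). \<forall>p. u p q = 0)"
proof -
  have c: "- x - y = - y - (x :: int)" for x y by simp
  have "u \<in> cell i j \<longleftrightarrow> (\<forall>p q. if p < length (f i) \<and> q < length (e j)
      then u p q \<in> poly_comp n (- f i ! p - e j ! q) else u p q = 0)"
    unfolding cell_def hcomp_free_module blocks_def by (auto simp: fun_eq_iff not_less) (metis not_le)
  also have "\<dots> \<longleftrightarrow> (\<forall>q<length (e j). (\<lambda>p. u p q) \<in> hcomp (FF i) (- e j ! q)) \<and>
     (\<forall>q\<ge>length (e j). \<forall>p. u p q = 0)"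
    unfolding hcomp_free_module blocks_def c[of "e j ! _"] by (auto simp: not_less) (meson not_le)+
  finally show ?thesis .
qed

lemma horiz_row:
  assumes "u \<in> cell i j"
  shows "horiz j u p = \<phi> j (u p)"
proof (cases "p < length (f i)")
  case True
  then show ?thesis using A[OF hcomp_free_carrier[OF cell_row[OF assms]]] by (simp add: horiz_def fun_eq_iff)
next
  case False
  then have "u p = 0" using cell_row_out[OF assms] by simp
  then show ?thesis using A[of 0 j] by (simp add: horiz_def[abs_def])
qed

lemma vert_column:
  assumes "(\<lambda>p. u p q) \<in> carrier (FF (Suc i))"
  shows "(\<lambda>p. vert i u p q) = \<delta> i (\<lambda>p. u p q)"
  using D[OF assms] by (simp add: vert_def fun_eq_iff)

lemma cell_column_carrier:
  "u \<in> cell i j \<Longrightarrow> (\<lambda>p. u p q) \<in> carrier (FF i)"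
  using hcomp_free_carrier[of "\<lambda>p. u p q" n "f i"]
  by (cases "q < length (e j)") (auto simp: cell_iff_columns not_less)

lemma vert_out: "(\<And>p. u p q = 0) \<Longrightarrow> vert i u p q = 0"
  by (simp add: vert_def mat_act_def)

lemma horiz_in_cell:
  assumes u: "u \<in> cell i j"
  shows "horiz j u \<in> cell i (Suc j)"
proof -
  have "horiz j u p \<in> hcomp (EE (Suc j)) (- f i ! p)" if "p < length (f i)" for p
    unfolding horiz_row[OF u] by (rule graded_homD(2)[OF \<phi> cell_row[OF u that]])
  moreover have "horiz j u p = 0" if "p \<ge> length (f i)" for p
    using cell_row_out[OF u that] by (simp add: horiz_def[abs_def] mat_act_simps)
  ultimately show ?thesis by (simp add: cell_def blocks_def)
qed

lemma vert_in_cell: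
  assumes u: "u \<in> cell (Suc i) j"
  shows "vert i u \<in> cell i j"
proof -
  have "(\<lambda>p. vert i u p q) \<in> hcomp (FF i) (- e j ! q)" if "q < length (e j)" for q
    unfolding vert_column[OF cell_column_carrier[OF u]]
    using u that by (intro graded_homD(2)[OF \<delta>]) (simp add: cell_iff_columns)
  moreover have "vert i u p q = 0" if "q \<ge> length (e j)" for p q
    using u that by (intro vert_out) (simp add: cell_iff_columns)
  ultimately show ?thesis by (simp add: cell_iff_columns)
qed

lemma horiz_horiz:
  assumes u: "u \<in> cell i j"
  shows "horiz (Suc j) (horiz j u) = 0"
proof
  fix p
  have "horiz (Suc j) (horiz j u) p = \<phi> (Suc j) (\<phi> j (u p))"
    by (simp add: horiz_row[OF u] horiz_row[OF horiz_in_cell[OF u]])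
  also have "\<dots> = 0"
  proof (cases "p < length (f i)")
    case True
    then show ?thesis by (intro \<phi>\<phi> hcomp_free_carrier[OF cell_row[OF u]])
  next
    case False
    then show ?thesis using \<phi>\<phi>[of 0 j] cell_row_out[OF u, of p] by simp
  qed
  finally show "horiz (Suc j) (horiz j u) p = 0 p" by simp
qed

text \<open>
  Since \<open>\<delta>\<close> acts on each column separately, exactness of the columns of the double complex
  follows from exactness of the resolution in the degrees \<open>- e j ! q\<close>.
\<close>

lemma lift_columns:
  assumes u: "u \<in> cell i j"
    and col: "\<And>q. q < length (e j) \<Longrightarrow> (\<lambda>p. u p q) \<in> \<delta> i ` carrier (FF (Suc i))"
  shows "u \<in> vert i ` cell (Suc i) j"
proof -
  have "\<forall>q. \<exists>w. q < length (e j) \<longrightarrow> w \<in> hcomp (FF (Suc i)) (- e j ! q) \<and> \<delta> i w = (\<lambda>p. u p q)"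
  proof (intro allI)
    fix q
    show "\<exists>w. q < length (e j) \<longrightarrow> w \<in> hcomp (FF (Suc i)) (- e j ! q) \<and> \<delta> i w = (\<lambda>p. u p q)"
    proof (cases "q < length (e j)")
      case True
      then have "(\<lambda>p. u p q) \<in> \<delta> i ` carrier (FF (Suc i)) \<inter> hcomp (FF i) (- e j ! q)"
        using col u by (simp add: cell_iff_columns)
      then show ?thesis unfolding graded_image[OF \<delta>] by force
    qed simp
  qed
  then obtain w where w: "\<And>q. q < length (e j) \<Longrightarrow> w q \<in> hcomp (FF (Suc i)) (- e j ! q)"
    "\<And>q. q < length (e j) \<Longrightarrow> \<delta> i (w q) = (\<lambda>p. u p q)" by metis
  define w' where "w' p q = (if q < length (e j) then w q p else 0)" for p q
  have "w' \<in> cell (Suc i) j" using w(1) by (simp add: cell_iff_columns w'_def)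
  moreover have "vert i w' p q = u p q" for p q
  proof (cases "q < length (e j)")
    case True
    then have "(\<lambda>p. vert i w' p q) = (\<lambda>p. u p q)"
      using vert_column[of w' q i] hcomp_free_carrier[OF w(1)] w(2)[OF True] by (simp add: w'_def)
    then show ?thesis by (rule fun_cong)
  next
    case False
    then show ?thesis using u vert_out[of w' q] by (simp add: cell_iff_columns w'_def)
  qed
  ultimately show ?thesis by (intro image_eqI[of _ _ w']) (auto simp: fun_eq_iff)
qed

lemma exact_cell: "{u \<in> cell (Suc i) j. vert i u = 0} = vert (Suc i) ` cell (Suc (Suc i)) j"
proof (intro equalityI subsetI)
  fix u assume "u \<in> {u \<in> cell (Suc i) j. vert i u = 0}"
  then have u: "u \<in> cell (Suc i) j" "vert i u = 0" by auto
  show "u \<in> vert (Suc i) ` cell (Suc (Suc i)) j"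
  proof (rule lift_columns[OF u(1)])
    fix q
    have "\<delta> i (\<lambda>p. u p q) = 0"
      using vert_column[of u q i, OF cell_column_carrier[OF u(1)]] u(2) by (simp add: fun_eq_iff)
    then show "(\<lambda>p. u p q) \<in> \<delta> (Suc i) ` carrier (FF (Suc (Suc i)))"
      using exact_\<delta>[OF cell_column_carrier[OF u(1)]] by blast
  qed
next
  fix u assume "u \<in> vert (Suc i) ` cell (Suc (Suc i)) j"
  then obtain w where w: "w \<in> cell (Suc (Suc i)) j" "u = vert (Suc i) w" by blast
  have u: "u \<in> cell (Suc i) j" unfolding w(2) by (rule vert_in_cell[OF w(1)])
  have "(\<lambda>p. vert i u p q) = 0" for q
    using vert_column[of u q i, OF cell_column_carrier[OF u]] exact_\<delta>[OF cell_column_carrier[OF u, of q]]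
      vert_column[of w q "Suc i", OF cell_column_carrier[OF w(1)]] cell_column_carrier[OF w(1), of q] w(2) by auto
  then have "vert i u = 0" by (simp add: fun_eq_iff)
  then show "u \<in> {u \<in> cell (Suc i) j. vert i u = 0}" using u by simp
qed

lemma horiz_vert: "horiz j (vert i u) = vert i (horiz j u)"
proof (intro ext)
  fix p q
  let ?s = "\<lambda>p' q'. u p' q' * D i p' p * A j q' q"
  have "horiz j (vert i u) p q = (\<Sum>q'<length (e j). \<Sum>p'<length (f (Suc i)). ?s p' q')"
    by (simp add: horiz_def vert_def mat_act_def sum_distrib_right)
  also have "\<dots> = (\<Sum>p'<length (f (Suc i)). \<Sum>q'<length (e j). ?s p' q')"
    by (rule sum.swap)
  also have "\<dots> = vert i (horiz j u) p q"
    unfolding horiz_def vert_def mat_act_def sum_distrib_right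
    by (intro sum.cong refl) (simp add: mult_ac)
  finally show "horiz j (vert i u) p q = vert i (horiz j u) p q" .
qed

sublocale C: double_complex wscale n cell horiz vert
proof (intro double_complex.intro vector_space_wscale double_complex_axioms.intro)
  interpret W: vector_space "wscale :: 'k \<Rightarrow> _" by (rule vector_space_wscale)
  interpret vector_space_pair "wscale :: 'k \<Rightarrow> _" "wscale :: 'k \<Rightarrow> _" ..
  show "fin_subspace wscale (cell i j)" for i j
    unfolding cell_def
    by (rule fin_subspace_blocks[OF vector_space_vscale]) (rule fin_subspace_hcomp_free)
  show "Vector_Spaces.linear wscale wscale (horiz j)" for j
    by unfold_locales
      (simp_all add: fun_eq_iff horiz_def mat_act_def distrib_right sum.distrib sum_distrib_left mult.assoc)
  show "Vector_Spaces.linear wscale wscale (vert i)" for i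
    by unfold_locales
      (simp_all add: fun_eq_iff vert_def mat_act_def distrib_right sum.distrib sum_distrib_left mult.assoc)
  show "cell i j = {0}" if "i > n" for i j
    using f_bound[OF that] by (auto simp: cell_def blocks_def)
qed (rule horiz_in_cell vert_in_cell horiz_horiz exact_cell horiz_vert; assumption?)+

definition cocyc :: "nat \<Rightarrow> (nat \<Rightarrow> 'k mpoly) set" where
  "cocyc j = {v \<in> carrier (EE j). \<phi> j v = 0}"

definition cobound :: "nat \<Rightarrow> (nat \<Rightarrow> 'k mpoly) set" where
  "cobound j = (case j of 0 \<Rightarrow> {0} | Suc i \<Rightarrow> \<phi> i ` carrier (EE i))"

lemma cohomology_eq: "cohomology n e \<phi> j = subquotient (EE j) (cocyc j) (cobound j)"
  by (cases j) (simp_all add: cohomology_def cocyc_def cobound_def a_kernel_def kernel_def)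

lemma \<phi>_add: "v \<in> carrier (EE j) \<Longrightarrow> w \<in> carrier (EE j) \<Longrightarrow> \<phi> j (v + w) = \<phi> j v + \<phi> j w"
  using LinearCombinations.module_hom_add[OF graded_homD(1)[OF \<phi>], of v j w] by simp

lemma \<phi>_smult: "r \<in> carrier (poly_ring n) \<Longrightarrow> v \<in> carrier (EE j) \<Longrightarrow> \<phi> j (\<lambda>i. r * v i) = (\<lambda>i. r * \<phi> j v i)"
  using LinearCombinations.module_hom_smult[OF graded_homD(1)[OF \<phi>], of r v j] by simp

lemma \<phi>_zero: "\<phi> j 0 = 0"
  using A[of 0 j] by (simp add: mat_act_simps)

lemma \<phi>_in: "v \<in> carrier (EE j) \<Longrightarrow> \<phi> j v \<in> carrier (EE (Suc j))"
  using LinearCombinations.module_hom_closed[OF graded_homD(1)[OF \<phi>]] by blast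

sublocale H: free_subquotient n "e j" "cocyc j" "cobound j" for j
proof
  have ED: "0 \<in> carrier (EE i)" "x \<in> carrier (EE i) \<Longrightarrow> y \<in> carrier (EE i) \<Longrightarrow> x + y \<in> carrier (EE i)"
    "p \<in> carrier (poly_ring n) \<Longrightarrow> x \<in> carrier (EE i) \<Longrightarrow> (\<lambda>k. p * x k) \<in> carrier (EE i)" for i x y p
    by (rule poly_submoduleD[OF poly_submodule_free_module]; assumption)+
  show "poly_submodule n (cocyc j)"
    unfolding poly_submodule_def cocyc_def
    using ED by (auto simp del: free_module_simps simp: \<phi>_zero \<phi>_add \<phi>_smult)
  show "poly_submodule n (cobound j)"
  proof (cases j)
    case 0
    then show ?thesis by (auto simp: poly_submodule_def cobound_def fun_eq_iff)
  next
    case (Suc i)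
    show ?thesis
      unfolding poly_submodule_def Suc cobound_def nat.case
    proof (intro conjI ballI)
      show "0 \<in> \<phi> i ` carrier (EE i)" using \<phi>_zero[of i] ED(1)[of i] by (metis image_eqI)
      show "x + y \<in> \<phi> i ` carrier (EE i)" if "x \<in> \<phi> i ` carrier (EE i)" "y \<in> \<phi> i ` carrier (EE i)" for x y
        using that \<phi>_add ED(2)[of _ i] by (auto simp del: free_module_simps simp: image_iff) metis
      show "(\<lambda>k. p * x k) \<in> \<phi> i ` carrier (EE i)" if "p \<in> carrier (poly_ring n)" "x \<in> \<phi> i ` carrier (EE i)" for p x
        using that \<phi>_smult ED(3)[of p _ i] by (auto simp del: free_module_simps simp: image_iff) metis
    qed
  qed
  show "cobound j \<subseteq> cocyc j"
    by (cases j) (auto simp del: free_module_simps simp: cobound_def cocyc_def \<phi>_zero \<phi>_in \<phi>\<phi> ED(1))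
  show "cocyc j \<subseteq> carrier (EE j)" by (auto simp: cocyc_def)
qed

lemma vpart_cocyc:
  assumes "w \<in> cocyc j"
  shows "vpart (e j) d w \<in> cocyc j"
proof -
  have w: "w \<in> carrier (EE j)" "\<phi> j w = 0" using assms by (simp_all add: cocyc_def)
  have "\<phi> j (vpart (e j) d w) = 0"
    using graded_hom_vpart[OF \<phi> w(1), of d] w(2) by (simp add: vpart_def fun_eq_iff)
  then show ?thesis
    using hcomp_free_carrier[OF vpart_in[OF w(1)]] by (simp add: cocyc_def del: free_module_simps)
qed

lemma vpart_cobound:
  assumes "w \<in> cobound j"
  shows "vpart (e j) d w \<in> cobound j"
proof (cases j)
  case 0
  then show ?thesis using assms by (simp add: cobound_def vpart_def fun_eq_iff)
next
  case (Suc i)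
  then obtain x where x: "x \<in> carrier (EE i)" "w = \<phi> i x" using assms by (auto simp: cobound_def)
  have "vpart (e j) d w = \<phi> i (vpart (e i) d x)"
    using graded_hom_vpart[OF \<phi> x(1), of d] Suc x(2) by simp
  then show ?thesis
    using hcomp_free_carrier[OF vpart_in[OF x(1)], of d] Suc by (simp add: cobound_def del: free_module_simps)
qed

text \<open>
  The coboundaries form a graded submodule, so the homogeneous part of a representative of a
  homogeneous class represents the same class.
\<close>

lemma coset_vpart:
  assumes w: "w \<in> cocyc j" and hom: "coset (cobound j) w \<in> hcomp (H.Q j) d"
  shows "coset (cobound j) (vpart (e j) d w) = coset (cobound j) w"
proof -
  obtain z where z: "z \<in> hcomp (EE j) d" "coset (cobound j) w = coset (cobound j) z"
    using hom unfolding subquotient_simps(5) by blast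
  have "w - z \<in> cobound j" using z(2) by (simp add: H.coset_eq_iff)
  then have "vpart (e j) d (w - z) \<in> cobound j" by (rule vpart_cobound)
  moreover have "vpart (e j) d (w - z) + vpart (e j) d z = vpart (e j) d w"
    by (simp add: vpart_def fun_eq_iff hpart_add[symmetric])
  then have "vpart (e j) d (w - z) = vpart (e j) d w - z"
    using vpart_homogeneous[OF z(1), of d] by (metis add_diff_cancel_right')
  ultimately have "vpart (e j) d w - z \<in> cobound j" by simp
  then show ?thesis unfolding z(2) by (simp add: H.coset_eq_iff)
qed

text \<open>
  Cocycles and coboundaries of a row are direct sums, over the generators of \<open>F\<^sub>i\<close>, of
  homogeneous components of cocycles and coboundaries of \<open>E\<close>.
\<close>

lemma coh_dim_cell:
  "C.coh_dim i j = (\<Sum>p<length (f i). int (comp_dim (cohomology n e \<phi> j) (- f i ! p)))"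
proof -
  interpret vector_space_pair "vscale :: 'k \<Rightarrow> _" "vscale :: 'k \<Rightarrow> _"
    by (intro vector_space_pair.intro vector_space_vscale)
  have Zfin: "fin_subspace vscale (cocyc j \<inter> hcomp (EE j) d)" for d
  proof -
    have "cocyc j \<inter> hcomp (EE j) d = {v \<in> hcomp (EE j) d. mat_act (length (e j)) (A j) v = 0}"
      using hcomp_free_carrier[of _ n "e j" d] A by (auto simp del: free_module_simps simp: cocyc_def)
    then show ?thesis using rank_nullity_on(3)[OF fin_subspace_hcomp_free linear_mat_act] by simp
  qed
  have "C.cocycles i j = blocks (length (f i)) (\<lambda>p. cocyc j \<inter> hcomp (EE j) (- f i ! p))"
  proof -
    have "(\<forall>p<length (f i). u p \<in> cocyc j) \<longleftrightarrow> horiz j u = 0" if u: "u \<in> cell i j" for u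
    proof -
      have "horiz j u = 0 \<longleftrightarrow> (\<forall>p. \<phi> j (u p) = 0)"
        by (auto simp: fun_eq_iff horiz_row[OF u])
      also have "\<dots> \<longleftrightarrow> (\<forall>p<length (f i). \<phi> j (u p) = 0)"
        using cell_row_out[OF u] \<phi>_zero by (metis not_less)
      also have "\<dots> \<longleftrightarrow> (\<forall>p<length (f i). u p \<in> cocyc j)"
        using hcomp_free_carrier[OF cell_row[OF u]] by (simp add: cocyc_def del: free_module_simps)
      finally show ?thesis by simp
    qed
    then show ?thesis unfolding C.cocycles_def by (auto simp: cell_def blocks_def)
  qed
  then have Z: "vdim wscale (C.cocycles i j) = (\<Sum>p<length (f i). vdim vscale (cocyc j \<inter> hcomp (EE j) (- f i ! p)))"
    using fin_subspace_blocks(2)[OF vector_space_vscale Zfin] by simp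
  have B: "(case j of 0 \<Rightarrow> 0 | Suc l \<Rightarrow> int (vdim wscale (horiz l ` cell i l)))
      = (\<Sum>p<length (f i). int (vdim vscale (cobound j \<inter> hcomp (EE j) (- f i ! p))))"
  proof (cases j)
    case 0
    have "cobound 0 \<inter> hcomp (EE 0) d = {0}" for d by (auto simp: cobound_def hcomp_free_module blocks_def)
    then show ?thesis using 0 vector_space.vdim_zero[OF vector_space_vscale] by simp
  next
    case (Suc l)
    have Bfin: "fin_subspace vscale (cobound (Suc l) \<inter> hcomp (EE (Suc l)) d)" for d
    proof -
      have "cobound (Suc l) \<inter> hcomp (EE (Suc l)) d = mat_act (length (e l)) (A l) ` hcomp (EE l) d"
        unfolding cobound_def nat.case graded_image[OF \<phi>]
        by (intro image_cong refl A hcomp_free_carrier)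
      then show ?thesis using rank_nullity_on(1)[OF fin_subspace_hcomp_free linear_mat_act] by simp
    qed
    have "horiz l ` cell i l = blocks (length (f i)) (\<lambda>p. cobound (Suc l) \<inter> hcomp (EE (Suc l)) (- f i ! p))"
    proof (intro equalityI subsetI)
      fix w assume "w \<in> horiz l ` cell i l"
      then obtain u where u: "u \<in> cell i l" "w = horiz l u" by blast
      have "horiz l u \<in> cell i (Suc l)" by (rule horiz_in_cell[OF u(1)])
      moreover have "horiz l u p \<in> cobound (Suc l)" if "p < length (f i)" for p
        unfolding horiz_row[OF u(1)] cobound_def nat.case
        by (intro imageI hcomp_free_carrier[OF cell_row[OF u(1) that]])
      ultimately show "w \<in> blocks (length (f i)) (\<lambda>p. cobound (Suc l) \<inter> hcomp (EE (Suc l)) (- f i ! p))"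
        unfolding u(2) by (auto simp: cell_def blocks_def)
    next
      fix w assume w: "w \<in> blocks (length (f i)) (\<lambda>p. cobound (Suc l) \<inter> hcomp (EE (Suc l)) (- f i ! p))"
      then have "\<forall>p. \<exists>v. p < length (f i) \<longrightarrow> v \<in> hcomp (EE l) (- f i ! p) \<and> \<phi> l v = w p"
        unfolding cobound_def nat.case graded_image[OF \<phi>] blocks_def by force
      then obtain u where u: "\<And>p. p < length (f i) \<Longrightarrow> u p \<in> hcomp (EE l) (- f i ! p)"
        "\<And>p. p < length (f i) \<Longrightarrow> \<phi> l (u p) = w p" by metis
      define u' where "u' p = (if p < length (f i) then u p else 0)" for p
      have u': "u' \<in> cell i l" using u(1) by (simp add: cell_def blocks_def u'_def)
      have "horiz l u' = w"
      proof
        fix p show "horiz l u' p = w p"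
          unfolding horiz_row[OF u'] using u(2)[of p] w by (auto simp: u'_def \<phi>_zero blocks_def not_less)
      qed
      then show "w \<in> horiz l ` cell i l" using u' by blast
    qed
    then have "vdim wscale (horiz l ` cell i l) = (\<Sum>p<length (f i). vdim vscale (cobound j \<inter> hcomp (EE j) (- f i ! p)))"
      using fin_subspace_blocks(2)[OF vector_space_vscale Bfin] Suc by simp
    then show ?thesis using Suc by simp
  qed
  show ?thesis
    unfolding C.coh_dim_def Z B cohomology_eq H.comp_dim_subquotient
    by (simp add: sum.distrib)
qed

lemma pairing_eq: "pairing n f e \<phi> = (\<Sum>i\<le>n. \<Sum>j\<le>i. (- 1) ^ (i - j) * C.coh_dim i j)"
proof -
  have mult: "(\<Sum>k\<in>set xs. int (count_list xs k) * g k) = (\<Sum>p<length xs. g (xs ! p))" for xs and g :: "int \<Rightarrow> int"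
  proof -
    have "(\<Sum>k\<in>S. int (count_list xs k) * g k) = sum_list (map g xs)"
      if "finite S" "set xs \<subseteq> S" for S
      using that
    proof (induction xs)
      case (Cons x xs)
      have "(\<Sum>k\<in>S. int (count_list (x # xs) k) * g k)
          = (\<Sum>k\<in>S. int (count_list xs k) * g k) + (\<Sum>k\<in>S. if x = k then g k else 0)"
        unfolding sum.distrib[symmetric] by (intro sum.cong refl) (simp add: algebra_simps)
      then show ?case using Cons by simp
    qed simp
    then show ?thesis by (simp add: sum_list_sum_nth atLeast0LessThan)
  qed
  have entry: "(\<Sum>k\<in>set (f i). (- 1) ^ (i - j) * int (count_list (f i) k) * int (comp_dim (cohomology n e \<phi> j) (- k)))
      = (- 1) ^ (i - j) * C.coh_dim i j" for i j
    unfolding coh_dim_cell mult[of "f i" "\<lambda>k. int (comp_dim (cohomology n e \<phi> j) (- k))", symmetric]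
      sum_distrib_left by (simp add: mult.assoc)
  have "pairing n f e \<phi> = (\<Sum>j\<in>{0..n}. \<Sum>i\<in>{j..n}. (- 1) ^ (i - j) * C.coh_dim i j)"
    unfolding pairing_def by (intro sum.cong refl entry)
  also have "\<dots> = (\<Sum>i\<le>n. \<Sum>j\<le>i. (- 1) ^ (i - j) * C.coh_dim i j)"
    unfolding sum.Sigma[OF finite_atLeastAtMost ballI[OF finite_atLeastAtMost]]
      sum.Sigma[OF finite_atMost ballI[OF finite_atMost]]
    by (rule sum.reindex_bij_witness[of _ "\<lambda>(i, j). (j, i)" "\<lambda>(j, i). (i, j)"]) auto
  finally show ?thesis .
qed

theorem pairing_nonneg: "pairing n f e \<phi> \<ge> 0"
  unfolding pairing_eq by (rule C.total_nonneg)

text \<open>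
  With \<open>M\<close> the cokernel of \<open>\<delta> 0\<close>, the two hypotheses say that \<open>(M \<otimes> E\<^sup>0)\<^sub>0 = 0\<close> and
  \<open>(F\<^sub>i \<otimes> H\<^bsup>i+1\<^esup>(E))\<^sub>0 = 0\<close>.
\<close>

theorem pairing_zero:
  assumes start: "\<And>q v. q < length (e 0) \<Longrightarrow> v \<in> hcomp (FF 0) (- e 0 ! q) \<Longrightarrow> v \<in> \<delta> 0 ` carrier (FF 1)"
    and acyclic: "\<And>i k. Suc i \<le> n \<Longrightarrow> k \<in> set (f i) \<Longrightarrow> cocyc (Suc i) \<inter> hcomp (EE (Suc i)) (- k) \<subseteq> cobound (Suc i)"
  shows "pairing n f e \<phi> = 0"
  unfolding pairing_eq
proof (rule C.total_zero)
  show "cell 0 0 \<subseteq> C.syz 0 0"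
    unfolding C.syz_def using lift_columns[of _ 0 0] start by (auto simp: cell_iff_columns)
next
  fix i
  show "C.cocycles i (Suc i) \<subseteq> horiz i ` cell i i"
  proof
    fix u assume "u \<in> C.cocycles i (Suc i)"
    then have u: "u \<in> cell i (Suc i)" "horiz (Suc i) u = 0" by (auto simp: C.cocycles_def)
    have "\<exists>v. p < length (f i) \<longrightarrow> v \<in> hcomp (EE i) (- f i ! p) \<and> \<phi> i v = u p" for p
    proof (cases "p < length (f i)")
      case True
      have up: "u p \<in> hcomp (EE (Suc i)) (- f i ! p)" by (rule cell_row[OF u(1) True])
      have "\<phi> (Suc i) (u p) = 0" using horiz_row[OF u(1), of p] u(2) by simp
      then have "u p \<in> cocyc (Suc i)" using hcomp_free_carrier[OF up] by (simp add: cocyc_def del: free_module_simps)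
      moreover have "0 \<in> cobound (Suc i)" using poly_submoduleD(1)[OF H.B] .
      \<comment> \<open>To the right of the last term of \<open>E\<close> there is nothing to prove.\<close>
      moreover have "u p = 0" if "\<not> Suc i \<le> n"
        using up e_bound[of "Suc i"] that by (simp add: hcomp_free_module blocks_def fun_eq_iff)
      ultimately have "u p \<in> cobound (Suc i)" using acyclic[of i "f i ! p"] up True by fastforce
      then have "u p \<in> \<phi> i ` carrier (EE i) \<inter> hcomp (EE (Suc i)) (- f i ! p)"
        using up by (simp add: cobound_def)
      then show ?thesis unfolding graded_image[OF \<phi>] by force
    qed simp
    then obtain v where v: "\<And>p. p < length (f i) \<Longrightarrow> v p \<in> hcomp (EE i) (- f i ! p)"
      "\<And>p. p < length (f i) \<Longrightarrow> \<phi> i (v p) = u p" by metis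
    define v' where "v' p = (if p < length (f i) then v p else 0)" for p
    have v': "v' \<in> cell i i" using v(1) by (simp add: cell_def blocks_def v'_def)
    have "horiz i v' = u"
    proof
      fix p show "horiz i v' p = u p"
        unfolding horiz_row[OF v'] using v(2)[of p] cell_row_out[OF u(1), of p]
        by (auto simp: v'_def \<phi>_zero not_less)
    qed
    then show "u \<in> horiz i ` cell i i" using v' by blast
  qed
qed

end

section \<open>Nonnegativity and vanishing of the pairing\<close>

text \<open>
  The images of the homogeneous parts of \<open>v\<close> form a homogeneous decomposition of \<open>\<epsilon> v\<close>. If \<open>\<epsilon> v\<close>
  is homogeneous, it is its own decomposition, and decompositions are unique.
\<close>

lemma graded_hom_part:
  fixes M :: "('k::field mpoly, 'm) gr_module" and \<epsilon> :: "(nat \<Rightarrow> 'k mpoly) \<Rightarrow> 'm"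
  assumes M: "graded_module n M"
    and \<epsilon>: "graded_hom n (free_module n a) M \<epsilon>"
    and v: "v \<in> carrier (free_module n a)" "\<epsilon> v \<in> hcomp M d"
  shows "\<epsilon> (vpart a d v) = \<epsilon> v"
proof -
  let ?F = "free_module n a :: ('k mpoly, _) gr_module"
  interpret M: graded_module n M by (rule M)
  note hom = graded_homD(1)[OF \<epsilon>]
  have H: "hcomp M c \<subseteq> carrier M" "\<zero>\<^bsub>M\<^esub> \<in> hcomp M c" for c
    using subgroup.subset[OF M.hcomp_subgroup[of c]] subgroup.one_closed[OF M.hcomp_subgroup[of c]] by auto
  have add: "\<epsilon> (x + y) = \<epsilon> x \<oplus>\<^bsub>M\<^esub> \<epsilon> y" if "x \<in> carrier ?F" "y \<in> carrier ?F" for x y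
    using LinearCombinations.module_hom_add[OF hom that] by simp
  have in_M: "\<epsilon> x \<in> carrier M" if "x \<in> carrier ?F" for x
    using LinearCombinations.module_hom_closed[OF hom] that by blast
  have "\<epsilon> (\<lambda>i. 0 * v i) = 0 \<odot>\<^bsub>M\<^esub> \<epsilon> v"
    using LinearCombinations.module_hom_smult[OF hom polys_closed(1) v(1)] by simp
  then have zero: "\<epsilon> 0 = \<zero>\<^bsub>M\<^esub>"
    using M.smult_l_null[OF in_M[OF v(1)]] by (simp add: zero_fun_def)
  obtain D where D: "finite D" "v = (\<Sum>c\<in>D. vpart a c v)" "\<And>c. c \<notin> D \<Longrightarrow> vpart a c v = 0"
    using vpart_expand[OF v(1)] by blast
  have vp: "vpart a c v \<in> carrier ?F" for c by (rule hcomp_free_carrier[OF vpart_in[OF v(1)]])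
  have sum: "\<epsilon> (\<Sum>c\<in>S. vpart a c v) = (\<Oplus>\<^bsub>M\<^esub>c\<in>S. \<epsilon> (vpart a c v))" if "finite S" for S
    using that
  proof (induction S)
    case (insert c S)
    have split: "\<epsilon> (\<Sum>c\<in>insert c S. vpart a c v) = \<epsilon> (vpart a c v) \<oplus>\<^bsub>M\<^esub> \<epsilon> (\<Sum>c\<in>S. vpart a c v)"
      unfolding sum.insert[OF insert(1,2)] by (rule add[OF vp free_carrier_sum[OF vp]])
    have "(\<Oplus>\<^bsub>M\<^esub>c\<in>insert c S. \<epsilon> (vpart a c v))
        = \<epsilon> (vpart a c v) \<oplus>\<^bsub>M\<^esub> (\<Oplus>\<^bsub>M\<^esub>c\<in>S. \<epsilon> (vpart a c v))"
      using insert in_M[OF vp] by (simp add: Pi_iff)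
    then show ?case by (simp only: split insert.IH)
  qed (simp only: sum.empty zero M.finsum_empty)
  define u where "u c = \<epsilon> (vpart a c v)" for c
  \<comment> \<open>The decomposition of \<open>\<epsilon> v\<close> with the single part \<open>\<epsilon> v\<close> in degree \<open>d\<close>.\<close>
  define u' where "u' c = (if c = d then \<epsilon> v else \<zero>\<^bsub>M\<^esub>)" for c
  have u_sub: "{c. u c \<noteq> \<zero>\<^bsub>M\<^esub>} \<subseteq> D" unfolding u_def using D(3) zero by fastforce
  have "\<epsilon> v = (\<Oplus>\<^bsub>M\<^esub>c\<in>D. u c)" using sum[OF D(1)] D(2) by (simp add: u_def)
  also have "\<dots> = (\<Oplus>\<^bsub>M\<^esub>c\<in>{c. u c \<noteq> \<zero>\<^bsub>M\<^esub>}. u c)"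
    using u_sub D(1) in_M[OF vp]
    by (intro M.add.finprod_mono_neutral_cong_right) (auto simp: u_def)
  finally have u: "(\<forall>c. u c \<in> hcomp M c) \<and> finite {c. u c \<noteq> \<zero>\<^bsub>M\<^esub>} \<and> \<epsilon> v = (\<Oplus>\<^bsub>M\<^esub>c\<in>{c. u c \<noteq> \<zero>\<^bsub>M\<^esub>}. u c)"
    using finite_subset[OF u_sub D(1)] graded_homD(2)[OF \<epsilon> vpart_in[OF v(1)]] by (simp add: u_def)
  have "{c. u' c \<noteq> \<zero>\<^bsub>M\<^esub>} = (if \<epsilon> v = \<zero>\<^bsub>M\<^esub> then {} else {d})" by (auto simp: u'_def)
  then have u': "(\<forall>c. u' c \<in> hcomp M c) \<and> finite {c. u' c \<noteq> \<zero>\<^bsub>M\<^esub>} \<and> \<epsilon> v = (\<Oplus>\<^bsub>M\<^esub>c\<in>{c. u' c \<noteq> \<zero>\<^bsub>M\<^esub>}. u' c)"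
    using v(2) H in_M[OF v(1)] by (auto simp: u'_def)
  have "u = u'" using M.hcomp_direct_sum[OF in_M[OF v(1)]] u u' by blast
  then show ?thesis by (metis u_def u'_def)
qed

lemma ereal_sum_negative:
  assumes "0 > x + (y :: ereal)" "ereal (real_of_int a) \<le> x" "ereal (real_of_int b) \<le> y"
  shows "a + b < 0"
proof -
  have "ereal (real_of_int a) + ereal (real_of_int b) \<le> x + y"
    using assms(2,3) by (rule add_mono)
  also note assms(1)
  finally have "real_of_int a + real_of_int b < 0" by simp
  then show ?thesis by linarith
qed

theorem theorem3p1:
  fixes n :: nat
    and e f :: "nat \<Rightarrow> int list"
    and \<phi> \<delta> :: "nat \<Rightarrow> (nat \<Rightarrow> 'k::field mpoly) \<Rightarrow> (nat \<Rightarrow> 'k mpoly)"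
    and \<epsilon> :: "(nat \<Rightarrow> 'k mpoly) \<Rightarrow> 'm"
    and M :: "('k mpoly, 'm) gr_module"
  assumes E: "free_cocomplex n e \<phi>"
    and M: "graded_module n M" "fin_gen_module n M"
    and F: "free_resolution n f \<delta> \<epsilon> M"
  shows "pairing n f e \<phi> \<ge> 0 \<and>
    (finite_length n M \<and>
     (\<forall>j\<in>{1..n}. finite_length n (cohomology n e \<phi> j)) \<and>
     0 > cm_reg n M + cm_reg n (free_module n (e 0) :: ('k mpoly, _) gr_module) \<and>
     (\<forall>j\<in>{1..n}. 0 > cm_reg n (free_module n (f (j - 1)) :: ('k mpoly, _) gr_module)
                      + cm_reg n (cohomology n e \<phi> j))
     \<longrightarrow> pairing n f e \<phi> = 0)"
proof -
  have E': "graded_hom n (free_module n (e j)) (free_module n (e (Suc j))) (\<phi> j)" for j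
    using E by (simp add: free_cocomplex_def)
  have F': "graded_hom n (free_module n (f (Suc i))) (free_module n (f i)) (\<delta> i)" for i
    using F by (simp add: free_resolution_def)
  have "\<exists>A. (\<forall>v. v \<in> carrier (free_module n (e j)) \<longrightarrow> \<phi> j v = mat_act (length (e j)) A v)
      \<and> (\<forall>p q. q \<ge> length (e (Suc j)) \<longrightarrow> A p q = 0)" for j
    by (rule free_hom_matrix[OF graded_homD(1)[OF E'[of j]]]) blast
  then obtain A where A: "\<And>j v. v \<in> carrier (free_module n (e j)) \<Longrightarrow> \<phi> j v = mat_act (length (e j)) (A j) v"
      "\<And>j p q. q \<ge> length (e (Suc j)) \<Longrightarrow> A j p q = 0" by metis
  have "\<exists>A. (\<forall>v. v \<in> carrier (free_module n (f (Suc i))) \<longrightarrow> \<delta> i v = mat_act (length (f (Suc i))) A v)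
      \<and> (\<forall>p q. q \<ge> length (f i) \<longrightarrow> A p q = 0)" for i
    by (rule free_hom_matrix[OF graded_homD(1)[OF F'[of i]]]) blast
  then obtain D where D: "\<And>i v. v \<in> carrier (free_module n (f (Suc i))) \<Longrightarrow> \<delta> i v = mat_act (length (f (Suc i))) (D i) v"
      "\<And>i p q. q \<ge> length (f i) \<Longrightarrow> D i p q = 0" by metis
  interpret T: tensor_complex n e f \<phi> \<delta> A D
  proof
    show "\<phi> (Suc j) (\<phi> j v) = 0" if "v \<in> carrier (free_module n (e j))" for j v
      using E that by (simp add: free_cocomplex_def)
    show "\<delta> i v = 0 \<longleftrightarrow> v \<in> \<delta> (Suc i) ` carrier (free_module n (f (Suc (Suc i))) :: ('k mpoly, _) gr_module)"
      if v: "v \<in> carrier (free_module n (f (Suc i)))" for i v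
    proof -
      have "a_kernel (free_module n (f (Suc i))) (free_module n (f i)) (\<delta> i)
          = \<delta> (Suc i) ` carrier (free_module n (f (Suc (Suc i))) :: ('k mpoly, _) gr_module)"
        using F by (simp add: free_resolution_def)
      then show ?thesis using v unfolding a_kernel_def kernel_def by auto
    qed
    show "e j = []" if "j > n" for j using E that by (simp add: free_cocomplex_def)
    show "f i = []" if "i > n" for i using F that by (simp add: free_resolution_def)
  qed (use E' F' A D in auto)
  have \<epsilon>: "graded_hom n (free_module n (f 0)) M \<epsilon>"
    and onto: "\<epsilon> ` carrier (free_module n (f 0)) = carrier M"
    and ker: "a_kernel (free_module n (f 0)) M \<epsilon> = \<delta> 0 ` carrier (T.FF 1)"
    using F by (simp_all add: free_resolution_def)
  interpret M: graded_module n M by (rule M(1))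
  have "pairing n f e \<phi> = 0" if fin: "finite_length n M" "\<And>j. j \<in> {1..n} \<Longrightarrow> finite_length n (cohomology n e \<phi> j)"
    and regM: "0 > cm_reg n M + cm_reg n (T.EE 0)"
    and regH: "\<And>j. j \<in> {1..n} \<Longrightarrow> 0 > cm_reg n (T.FF (j - 1)) + cm_reg n (cohomology n e \<phi> j)"
  proof (rule T.pairing_zero)
    fix q v assume q: "q < length (e 0)" and v: "v \<in> hcomp (T.FF 0) (- e 0 ! q)"
    \<comment> \<open>A nonzero element of \<open>M\<close> of degree \<open>- e 0 ! q\<close> would give \<open>reg M + reg E\<^sup>0 \<ge> 0\<close>.\<close>
    have "\<epsilon> v = \<zero>\<^bsub>M\<^esub>"
    proof (rule ccontr)
      assume nz: "\<epsilon> v \<noteq> \<zero>\<^bsub>M\<^esub>"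
      have "ereal (real_of_int (- e 0 ! q)) \<le> cm_reg n M"
      proof (rule cm_reg_ge_degree[where \<pi> = \<epsilon> and Z = "carrier (T.FF 0)" and a = "f 0"])
        show "Module.module (poly_ring n) M" by (rule M.module_axioms)
        show "hcomp M d \<subseteq> carrier M" for d using subgroup.subset[OF M.hcomp_subgroup[of d]] by simp
        show "poly_submodule n (carrier (T.FF 0))" by (rule poly_submodule_free_module)
        show "vpart (f 0) d v \<in> carrier (T.FF 0)" if "v \<in> carrier (T.FF 0)" for v d
          by (rule hcomp_free_carrier[OF vpart_in[OF that]])
        show "\<epsilon> (v + w) = \<epsilon> v \<oplus>\<^bsub>M\<^esub> \<epsilon> w" if "v \<in> carrier (T.FF 0)" "w \<in> carrier (T.FF 0)" for v w
          using LinearCombinations.module_hom_add[OF graded_homD(1)[OF \<epsilon>] that] by simp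
        show "\<epsilon> (\<lambda>i. p * v i) = p \<odot>\<^bsub>M\<^esub> \<epsilon> v" if "p \<in> carrier (poly_ring n)" "v \<in> carrier (T.FF 0)" for p v
          using LinearCombinations.module_hom_smult[OF graded_homD(1)[OF \<epsilon>] that] by simp
        show "\<epsilon> (vpart (f 0) d v) = \<epsilon> v" if "v \<in> carrier (T.FF 0)" "\<epsilon> v \<in> hcomp M d" for v d
          by (rule graded_hom_part[OF M(1) \<epsilon> that])
        show "\<epsilon> v \<in> hcomp M (- e 0 ! q)" by (rule graded_homD(2)[OF \<epsilon> v])
      qed (use M.hcomp_smult fin(1) onto nz in auto)
      moreover have "ereal (real_of_int (e 0 ! q)) \<le> cm_reg n (T.EE 0)"
        using q by (intro cm_reg_free_module_ge) simp
      ultimately show False using ereal_sum_negative[OF regM] by fastforce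
    qed
    then show "v \<in> \<delta> 0 ` carrier (T.FF 1)"
      unfolding ker[symmetric] a_kernel_def kernel_def using hcomp_free_carrier[OF v] by simp
  next
    fix i k assume i: "Suc i \<le> n" and k: "k \<in> set (f i)"
    let ?j = "Suc i"
    have coh: "cohomology n e \<phi> ?j = T.H.Q ?j" by (rule T.cohomology_eq)
    \<comment> \<open>A nonzero class of degree \<open>- k\<close> would give \<open>reg F\<^sub>i + reg H\<^bsup>i+1\<^esup>(E) \<ge> 0\<close>.\<close>
    show "T.cocyc ?j \<inter> hcomp (T.EE ?j) (- k) \<subseteq> T.cobound ?j"
    proof (rule ccontr)
      assume "\<not> ?thesis"
      then obtain v where v: "v \<in> T.cocyc ?j" "v \<in> hcomp (T.EE ?j) (- k)" "v \<notin> T.cobound ?j" by blast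
      have "ereal (real_of_int (- k)) \<le> cm_reg n (cohomology n e \<phi> ?j)"
        unfolding coh
      proof (rule cm_reg_ge_degree[where \<pi> = "coset (T.cobound ?j)" and Z = "T.cocyc ?j" and a = "e ?j"])
        show "Module.module (poly_ring n) (T.H.Q ?j)" by (rule T.H.module_subquotient)
        show "hcomp (T.H.Q ?j) d \<subseteq> carrier (T.H.Q ?j)" for d by (rule T.H.hcomp_subquotient_subspace)
        show "p \<odot>\<^bsub>T.H.Q ?j\<^esub> x \<in> hcomp (T.H.Q ?j) (c + d)"
          if "p \<in> poly_comp n c" "x \<in> hcomp (T.H.Q ?j) d" for p x c d
          by (rule T.H.hcomp_subquotient_subspace(4)[OF that])
        show "finite_length n (T.H.Q ?j)" using fin(2)[of ?j] i coh by simp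
        show "poly_submodule n (T.cocyc ?j)" by (rule T.H.Z)
        show "T.cocyc ?j \<subseteq> carrier (T.EE ?j)" by (rule T.H.ZF)
        show Zpart: "vpart (e ?j) d w \<in> T.cocyc ?j" if "w \<in> T.cocyc ?j" for w d
          by (rule T.vpart_cocyc[OF that])
        show "coset (T.cobound ?j) ` T.cocyc ?j = carrier (T.H.Q ?j)" by (simp add: T.H.carrier_subquotient)
        show "coset (T.cobound ?j) (w + w') = coset (T.cobound ?j) w \<oplus>\<^bsub>T.H.Q ?j\<^esub> coset (T.cobound ?j) w'" for w w'
          by (simp add: T.H.coset_add)
        show "coset (T.cobound ?j) (\<lambda>i. p * w i) = p \<odot>\<^bsub>T.H.Q ?j\<^esub> coset (T.cobound ?j) w"
          if "p \<in> carrier (poly_ring n)" for p w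
          by (simp add: T.H.coset_smult[OF that])
        show "coset (T.cobound ?j) (vpart (e ?j) d w) = coset (T.cobound ?j) w"
          if "w \<in> T.cocyc ?j" "coset (T.cobound ?j) w \<in> hcomp (T.H.Q ?j) d" for w d
          by (rule T.coset_vpart[OF that])
        show "coset (T.cobound ?j) v \<in> hcomp (T.H.Q ?j) (- k)" using v by (auto simp: subquotient_simps(5))
        show "coset (T.cobound ?j) v \<noteq> \<zero>\<^bsub>T.H.Q ?j\<^esub>"
          using v(3) by (simp add: subquotient_simps(2) T.H.coset_eq_zero_iff)
      qed
      moreover have "ereal (real_of_int k) \<le> cm_reg n (T.FF i)"
        using k by (rule cm_reg_free_module_ge)
      ultimately show False
        using ereal_sum_negative[OF regH[of ?j]] i by fastforce
    qed
  qed
  then show ?thesis using T.pairing_nonneg by blast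
qed

end
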